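(* Let $z_0\in(0,1)$ and $T>0$. For $x_0\in[-1,1]$ let $r=r(T,x_0)\in(0,1)$ be the (unique) solution of the equation \begin{align*} &(1+x_0)(1-z_0)^2\log(1-r)+(1-x_0)(1+z_0)^2\log(1+r)-(1-2x_0z_0+z_0^2)\log r\\ &=(1+x_0)(1-z_0)^2\log(1-z_0)+(1-x_0)(1+z_0)^2\log(1+z_0)-(1-2x_0z_0+z_0^2)\log (e^{-T}z_0), \end{align*} and let $$\sigma(T,x_0)=\frac{2(1-z_0^2)\sqrt{1-x_0^2}}{1-2x_0z_0+z_0^2}\left(\operatorname{arctanh} z_0-\operatorname{arctanh} r(T,x_0)\right).$$ Put $w_\pm(x_0):=r(T,x_0)e^{\pm i\sigma(T,x_0)}$ and define the two curves $$C_\pm(z_0):=\{w_\pm(x_0)\,:\,x_0\in[-1,1]\}.$$ Then the following hold. (i) If $\operatorname{arctanh} z_0<\frac{\pi}{2}$, then $V_T(z_0)$ is the closed region whose boundary consists of the two curves $C_+(z_0)$ and $C_-(z_0)$, which only intersect at $x_0\in\{-1,1\}$. (ii) If $\operatorname{arctanh} z_0\geq\frac{\pi}{2}$ and $T$ is large enough that the equation $$\frac{2(1-z_0^2)\sqrt{1-x^2}}{1-2xz_0+z_0^2}\left(\operatorname{arctanh} z_0-\operatorname{arctanh} r(T,x)\right)=\pi\qquad(\ast)$$ admits a solution $x\in[-1,1]$, then the curves $C_+(z_0)$ and $C_-(z_0)$ intersect more than twice; there is a $\chi\in(-1,1)$ such that $\widetilde C_+(z_0)\cup\widetilde C_-(z_0)$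 is a closed Jordan curve, where $\widetilde C_\pm(z_0):=\{w_\pm(x_0)\,:\,x_0\in[\chi,1]\}$, and there is an $\aleph\in(-1,1)$ such that $\widehat C_+(z_0)\cup\widehat C_-(z_0)$ is a closed Jordan curve, where $\widehat C_\pm(z_0):=\{w_\pm(x_0)\,:\,x_0\in[-1,\aleph]\}$; and $V_T(z_0)$ is the closed region whose boundary is $\widetilde C_+(z_0)\cup\widetilde C_-(z_0)\cup\widehat C_+(z_0)\cup\widehat C_-(z_0)$. (iii) If $\operatorname{arctanh} z_0\geq\frac{\pi}{2}$ and $T$ is smaller, so that $(\ast)$ has no solution $x\in[-1,1]$, then $V_T(z_0)$ is described exactly as in (i): it is the closed region whose boundary consists of the two curves $C_+(z_0)$ and $C_-(z_0)$, which only intersect at $x_0\in\{-1,1\}$.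
   Context: $\mathbb{D}=\{z\in\mathbb{C}:|z|<1\}$ is the open unit disc. "Univalent" means holomorphic and injective. For $T>0$, $$\mathcal S_T:=\{f:\mathbb{D}\to\mathbb{D}\text{ univalent},\ f(0)=0,\ f'(0)=e^{-T}\},\qquad V_T(z_0):=\{f(z_0)\,:\,f\in\mathcal S_T\}.$$ The closed region whose boundary is a single closed Jordan curve is the union of the curve and its bounded complementary component. In case (ii), the closed region whose boundary is the union of the two Jordan curves is the set of points lying on or inside the outer curve $\widetilde C_+(z_0)\cup\widetilde C_-(z_0)$ and not strictly inside the inner curve $\widehat C_+(z_0)\cup\widehat C_-(z_0)$. That the two curves "only intersect at $x_0\in\{-1,1\}$" means that their only common points are $w_+(\pm1)=w_-(\pm1)$. *)

theory Defs
  imports "HOL-Analysis.Analysis"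
begin

definition univalent_class :: "real \<Rightarrow> (complex \<Rightarrow> complex) set" where
  "univalent_class T =
     {f. f holomorphic_on ball 0 1 \<and> inj_on f (ball 0 1) \<and> f ` ball 0 1 \<subseteq> ball 0 1 \<and>
         f 0 = 0 \<and> deriv f 0 = complex_of_real (exp (- T))}"

definition value_range :: "real \<Rightarrow> complex \<Rightarrow> complex set" where
  "value_range T z = {f z | f. f \<in> univalent_class T}"

definition radius_equation :: "real \<Rightarrow> real \<Rightarrow> real \<Rightarrow> real \<Rightarrow> bool" where
  "radius_equation z0 T x r \<longleftrightarrow>
     (1 + x) * (1 - z0)\<^sup>2 * ln (1 - r) + (1 - x) * (1 + z0)\<^sup>2 * ln (1 + r)
       - (1 - 2 * x * z0 + z0\<^sup>2) * ln r
   = (1 + x) * (1 - z0)\<^sup>2 * ln (1 - z0) + (1 - x) * (1 + z0)\<^sup>2 * ln (1 + z0)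
       - (1 - 2 * x * z0 + z0\<^sup>2) * ln (exp (- T) * z0)"

definition radius :: "real \<Rightarrow> real \<Rightarrow> real \<Rightarrow> real" where
  "radius z0 T x = (THE r. r \<in> {0<..<1} \<and> radius_equation z0 T x r)"

definition angle :: "real \<Rightarrow> real \<Rightarrow> real \<Rightarrow> real" where
  "angle z0 T x =
     2 * (1 - z0\<^sup>2) * sqrt (1 - x\<^sup>2) / (1 - 2 * x * z0 + z0\<^sup>2)
       * (artanh z0 - artanh (radius z0 T x))"

definition w_plus :: "real \<Rightarrow> real \<Rightarrow> real \<Rightarrow> complex" where
  "w_plus z0 T x = complex_of_real (radius z0 T x) * exp (\<i> * complex_of_real (angle z0 T x))"

definition w_minus :: "real \<Rightarrow> real \<Rightarrow> real \<Rightarrow> complex" where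
  "w_minus z0 T x = complex_of_real (radius z0 T x) * exp (- \<i> * complex_of_real (angle z0 T x))"

definition C_plus :: "real \<Rightarrow> real \<Rightarrow> complex set" where
  "C_plus z0 T = w_plus z0 T ` {-1..1}"

definition C_minus :: "real \<Rightarrow> real \<Rightarrow> complex set" where
  "C_minus z0 T = w_minus z0 T ` {-1..1}"

definition C_tilde_plus :: "real \<Rightarrow> real \<Rightarrow> real \<Rightarrow> complex set" where
  "C_tilde_plus z0 T chi = w_plus z0 T ` {chi..1}"

definition C_tilde_minus :: "real \<Rightarrow> real \<Rightarrow> real \<Rightarrow> complex set" where
  "C_tilde_minus z0 T chi = w_minus z0 T ` {chi..1}"

definition C_hat_plus :: "real \<Rightarrow> real \<Rightarrow> real \<Rightarrow> complex set" where
  "C_hat_plus z0 T aleph = w_plus z0 T ` {-1..aleph}"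

definition C_hat_minus :: "real \<Rightarrow> real \<Rightarrow> real \<Rightarrow> complex set" where
  "C_hat_minus z0 T aleph = w_minus z0 T ` {-1..aleph}"

definition closed_Jordan_curve :: "complex set \<Rightarrow> bool" where
  "closed_Jordan_curve J \<longleftrightarrow>
     (\<exists>g. simple_path g \<and> pathfinish g = pathstart g \<and> path_image g = J)"

(* For a closed Jordan curve J, the library's set inside J is the bounded component of - J. *)

definition Jordan_region :: "complex set \<Rightarrow> complex set" where
  "Jordan_region J = J \<union> inside J"

(* Only the part strictly inside the inner curve is removed, so a point at which the two
   curves touch belongs to the region. *)

definition Jordan_ring :: "complex set \<Rightarrow> complex set \<Rightarrow> complex set" where
  "Jordan_ring J_out J_in = Jordan_region J_out - inside J_in"

end

theory Submission
  imports Defs "HOL-Complex_Analysis.Complex_Analysis"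
begin

text \<open>Put \<open>r = |f z|\<close> and let \<open>T + log (f z / z) = L + i \<theta>\<close> with the branch that is \<open>0\<close> at the
  origin. The theorem amounts to the statement that the pairs \<open>(r, L + i \<theta>)\<close> that occur are exactly
  those for which \<open>L + i \<theta>\<close> lies in the closed disc of centre
  \<open>log ((1 - r\<^sup>2) / (1 - z\<^sup>2))\<close> and radius \<open>2 (artanh z - artanh r)\<close>; as \<open>L\<close> is determined by \<open>r\<close>, this
  bounds \<open>|\<theta>|\<close> by an explicit function of \<open>r\<close>, whose graph is the curve in the theorem. Both
  directions replace Loewner's equation by a compactness argument. For the inclusion, the excess over the
  radius is subadditive under composition and is \<open>o(t)\<close> for maps with derivative \<open>exp (- t)\<close> at
  \<open>0\<close> (Schwarz's lemma for \<open>- log (f z / z)\<close>), and every map that is not the identity has an outer factor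
  with arbitrarily small \<open>t > 0\<close> (Riemann mapping onto a domain slightly smaller than the disc).
  For attainment, one composes many small explicit univalent maps, each of which moves the image point
  in the prescribed direction, and passes to the limit.\<close>

section \<open>Logarithms of bounded univalent functions\<close>

text \<open>Schwarz's lemma bounds a short step by a quadratic form in \<open>t\<close>,
  \<open>Re l\<close> and \<open>Im l\<close>. Completing the square at fixed \<open>t\<close> gives
  the familiar disc for \<open>l\<close>. Completing it at fixed \<open>Re l\<close> instead gives a
  disc for \<open>t + l\<close> whose centre and radius are proportional to the loss
  \<open>- Re l\<close> of log |z|, with factors that depend on |z| alone. These are exact
  differentials, so along a chain of compositions they add up to differences of two potentials of
  |z|, whatever the path. Keeping one relative position in all the infinitesimal discs therefore
  leads to the same relative position in the final disc; this is how every point of it is reached.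
  The branch \<open>\<theta>\<close> is not reduced modulo 2 pi. Once its bound reaches pi at some
  radius, the whole circle of that radius belongs to the value set and the region closes up into a
  ring around the origin. That the radii of such circles form a single interval needs a separate
  concavity argument.\<close>

definition log_class :: "real \<Rightarrow> (complex \<Rightarrow> complex) set" where
  "log_class t =
     {l. l holomorphic_on ball 0 1 \<and> l 0 = - complex_of_real t \<and>
         (\<forall>z\<in>ball 0 1. Re (l z) \<le> 0) \<and> inj_on (\<lambda>z. z * exp (l z)) (ball 0 1)}"

lemma log_classD:
  assumes "l \<in> log_class t"
  shows "l holomorphic_on ball 0 1" "l 0 = - complex_of_real t"
    "\<And>z. norm z < 1 \<Longrightarrow> Re (l z) \<le> 0" "inj_on (\<lambda>z. z * exp (l z)) (ball 0 1)"
  using assms by (auto simp: log_class_def)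

lemma norm_times_exp_le:
  assumes "l \<in> log_class t" "norm z < 1"
  shows "norm (z * exp (l z)) \<le> norm z"
  using log_classD(3)[OF assms] by (simp add: norm_mult mult_left_le)

text \<open>The logarithm of f(z)/z is additive along compositions, with the outer term evaluated at
  the image point, and so is the parameter \<open>t\<close>. This is why the argument runs in terms
  of \<open>l\<close> instead of \<open>f\<close>.\<close>

lemma log_class_compose:
  assumes l1: "l1 \<in> log_class s" and l2: "l2 \<in> log_class t"
  shows "(\<lambda>z. l1 z + l2 (z * exp (l1 z))) \<in> log_class (s + t)"
proof -
  let ?f = "\<lambda>z. z * exp (l1 z)"
  have f: "?f ` ball 0 1 \<subseteq> ball 0 1"
    using norm_times_exp_le[OF l1] by fastforce
  have hf: "?f holomorphic_on ball 0 1"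
    using log_classD(1)[OF l1] by (intro holomorphic_intros)
  have hl2f: "(\<lambda>z. l2 (?f z)) holomorphic_on ball 0 1"
    using holomorphic_on_compose_gen[OF hf log_classD(1)[OF l2] f] by (simp add: o_def)
  have "inj_on ((\<lambda>z. z * exp (l2 z)) \<circ> ?f) (ball 0 1)"
    using f log_classD(4)[OF l1] log_classD(4)[OF l2]
    by (meson comp_inj_on inj_on_subset)
  moreover have "(\<lambda>z. z * exp (l2 z)) \<circ> ?f = (\<lambda>z. z * exp (l1 z + l2 (?f z)))"
    by (auto simp: exp_add)
  ultimately show ?thesis
    using hl2f log_classD(1)[OF l1] log_classD(2)[OF l1] log_classD(2)[OF l2]
      log_classD(3)[OF l1] log_classD(3)[OF l2] f
    by (auto simp: log_class_def add_nonpos_nonpos image_subset_iff intro!: holomorphic_intros)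
qed

text \<open>Injectivity together with \<open>f 0 = 0\<close> makes f(z)/z zero-free away from the
  origin, and the derivative does so at the origin; hence a logarithm exists. The sign of its real
  part is Schwarz's lemma.\<close>

lemma univalent_class_imp_log:
  assumes f: "f \<in> univalent_class t"
  obtains l where "l \<in> log_class t" "\<And>z. norm z < 1 \<Longrightarrow> f z = z * exp (l z)"
proof -
  have hf: "f holomorphic_on ball 0 1" and inj: "inj_on f (ball 0 1)"
    and sub: "f ` ball 0 1 \<subseteq> ball 0 1" and f0: "f 0 = 0"
    and d: "deriv f 0 = complex_of_real (exp (- t))"
    using f by (auto simp: univalent_class_def)
  obtain h where hh: "h holomorphic_on ball 0 1" and fh: "\<And>z. norm z < 1 \<Longrightarrow> f z = z * h z"
    and h0: "deriv f 0 = h 0"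
    using Schwarz3[OF hf f0] by blast
  have fle: "norm (f z) \<le> norm z" if "norm z < 1" for z
    using Schwarz_Lemma(1)[OF hf f0 _ that] sub by (auto simp: image_subset_iff)
  have d1: "norm (deriv f 0) \<le> 1"
    using Schwarz_Lemma(2)[OF hf f0, of 0] sub by (auto simp: image_subset_iff)
  have hnz: "h z \<noteq> 0" if z: "z \<in> ball 0 1" for z
  proof (cases "z = 0")
    case True then show ?thesis using h0 d by (metis exp_not_eq_zero of_real_eq_0_iff)
  next
    case False
    then have "f z \<noteq> f 0" using inj z by (auto simp: inj_on_def)
    then show ?thesis using fh[of z] z f0 by auto
  qed
  obtain g where hg: "g holomorphic_on ball 0 1" and g: "\<And>z. z \<in> ball 0 1 \<Longrightarrow> h z = exp (g z)"
    using contractible_imp_holomorphic_log[OF hh _ hnz] convex_imp_contractible[OF convex_ball] by metis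
  \<comment> \<open>\<open>exp (g 0)\<close> equals \<open>exp (- t)\<close>, so this shifts
    \<open>g\<close> by a multiple of 2 pi i and selects the branch with
    \<open>l 0 = - t\<close>.\<close>
  define l where "l z = g z - g 0 - complex_of_real t" for z
  have eg0: "exp (g 0) = exp (- complex_of_real t)"
    using g[of 0] h0 d exp_of_real[of "- t", where ?'a = complex] by simp
  have fl: "f z = z * exp (l z)" if "norm z < 1" for z
    using fh[OF that] g[of z] that eg0 by (simp add: l_def exp_diff exp_minus divide_simps)
  have "Re (l z) \<le> 0" if z: "norm z < 1" for z
  proof (cases "z = 0")
    case True
    then show ?thesis using d1 d by (simp add: l_def)
  next
    case False
    have "norm z * exp (Re (l z)) \<le> norm z * 1"
      using fle[OF z] by (simp add: fl[OF z] norm_mult)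
    then show ?thesis using False by simp
  qed
  moreover have "inj_on (\<lambda>z. z * exp (l z)) (ball 0 1)"
    using inj fl by (simp add: inj_on_def)
  ultimately have "l \<in> log_class t"
    using hg by (auto simp: log_class_def l_def[abs_def] intro!: holomorphic_intros)
  then show ?thesis using fl that by blast
qed

lemma log_imp_univalent_class:
  assumes l: "l \<in> log_class t" and t: "t > 0"
  shows "(\<lambda>z. z * exp (l z)) \<in> univalent_class t"
proof -
  have hl: "l holomorphic_on ball 0 1" using log_classD[OF l] by simp
  have "((\<lambda>z. z * exp (l z)) has_field_derivative exp (l 0)) (at 0)"
    using holomorphic_derivI[OF hl, of 0] by (auto intro!: derivative_eq_intros)
  then have "deriv (\<lambda>z. z * exp (l z)) 0 = complex_of_real (exp (- t))"
    using log_classD(2)[OF l] exp_of_real[of "- t", where ?'a = complex] by (simp add: DERIV_imp_deriv)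
  moreover have "(\<lambda>z. z * exp (l z)) ` ball 0 1 \<subseteq> ball 0 1"
    using norm_times_exp_le[OF l] by fastforce
  ultimately show ?thesis
    using log_classD[OF l] by (auto simp: univalent_class_def intro!: holomorphic_intros)
qed

text \<open>For \<open>t > 0\<close> this says that \<open>- l z / t\<close> lies in the image of the disc of radius \<open>|z|\<close> under
  \<open>(1 + \<zeta>) / (1 - \<zeta>)\<close>. The denominators are cleared so that \<open>t = 0\<close> is covered, where it says \<open>l z = 0\<close>.\<close>

lemma herglotz_disc:
  assumes hl: "l holomorphic_on ball 0 1" and l0: "l 0 = - complex_of_real t" and t: "t \<ge> 0"
    and re: "\<And>z. norm z < 1 \<Longrightarrow> Re (l z) \<le> 0" and z: "norm z < 1"
  shows "(norm (l z))\<^sup>2 * (1 - (norm z)\<^sup>2) + 2 * t * (1 + (norm z)\<^sup>2) * Re (l z) + t\<^sup>2 * (1 - (norm z)\<^sup>2) \<le> 0"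
proof -
  define r where "r = norm z"
  \<comment> \<open>Shifting \<open>l\<close> by \<open>e\<close> makes its real part strictly
    negative and its value at \<open>0\<close> equal to \<open>- (t + e) < 0\<close>, so the Cayley
    transform \<open>?w\<close> below is defined and vanishes at \<open>0\<close> even when
    \<open>t = 0\<close>. At the end \<open>e\<close> tends to \<open>0\<close>.\<close>
  have *: "(norm (l z - of_real e))\<^sup>2 * (1 - r\<^sup>2) + 2 * (t + e) * (1 + r\<^sup>2) * (Re (l z) - e) + (t + e)\<^sup>2 * (1 - r\<^sup>2) \<le> 0"
    if e: "e > 0" for e
  proof -
    define m where "m \<zeta> = l \<zeta> - of_real e" for \<zeta>
    define u where "u = t + e"
    have u: "u > 0" using t e by (simp add: u_def)
    have rem: "Re (m \<zeta>) < 0" if "norm \<zeta> < 1" for \<zeta> using re[OF that] e by (simp add: m_def)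
    have ne: "m \<zeta> - of_real u \<noteq> 0" if "norm \<zeta> < 1" for \<zeta>
    proof
      assume "m \<zeta> - of_real u = 0"
      then have "Re (m \<zeta> - of_real u) = 0" by simp
      then show False using rem[OF that] u by simp
    qed
    have sq: "(norm (m \<zeta> + of_real u))\<^sup>2 = (norm (m \<zeta>))\<^sup>2 + 2 * u * Re (m \<zeta>) + u\<^sup>2"
      "(norm (m \<zeta> - of_real u))\<^sup>2 = (norm (m \<zeta>))\<^sup>2 - 2 * u * Re (m \<zeta>) + u\<^sup>2" for \<zeta>
      by (simp_all add: cmod_power2 power2_sum power2_diff)
    let ?w = "\<lambda>\<zeta>. (m \<zeta> + of_real u) / (m \<zeta> - of_real u)"
    have hw: "?w holomorphic_on ball 0 1"
      using hl ne by (auto simp: m_def[abs_def] intro!: holomorphic_intros)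
    have w0: "?w 0 = 0" using l0 by (simp add: m_def u_def)
    have w1: "norm (?w \<zeta>) < 1" if "norm \<zeta> < 1" for \<zeta>
    proof -
      have "(norm (m \<zeta> + of_real u))\<^sup>2 < (norm (m \<zeta> - of_real u))\<^sup>2"
        using rem[OF that] u unfolding sq by (simp add: mult_pos_neg)
      then have "norm (m \<zeta> + of_real u) < norm (m \<zeta> - of_real u)"
        by (rule power2_less_imp_less) simp
      then show ?thesis using ne[OF that] by (simp add: norm_divide divide_simps)
    qed
    have "norm (?w z) \<le> r"
      using Schwarz_Lemma(1)[OF hw w0 w1 z] by (simp add: r_def)
    then have "norm (m z + of_real u) \<le> r * norm (m z - of_real u)"
      using ne[OF z] by (simp add: norm_divide divide_simps)
    then have "(norm (m z + of_real u))\<^sup>2 \<le> (r * norm (m z - of_real u))\<^sup>2"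
      by (intro power_mono) auto
    then have "(norm (m z))\<^sup>2 + 2 * u * Re (m z) + u\<^sup>2 \<le> r\<^sup>2 * ((norm (m z))\<^sup>2 - 2 * u * Re (m z) + u\<^sup>2)"
      unfolding power_mult_distrib sq .
    then show ?thesis by (simp add: m_def u_def algebra_simps)
  qed
  let ?F = "\<lambda>e. (norm (l z - of_real e))\<^sup>2 * (1 - r\<^sup>2) + 2 * (t + e) * (1 + r\<^sup>2) * (Re (l z) - e) + (t + e)\<^sup>2 * (1 - r\<^sup>2)"
  have "(?F \<longlongrightarrow> ?F 0) (at_right 0)"
    by (intro tendsto_intros)
  moreover have "\<forall>\<^sub>F e in at_right 0. ?F e \<le> 0"
    by (rule eventually_mono[OF eventually_at_right_less *])
  ultimately have "?F 0 \<le> 0"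
    by (rule tendsto_upperbound) auto
  then show ?thesis by (simp add: r_def)
qed

section \<open>Bounds and compactness for the logarithms\<close>

lemma log_class_disc:
  assumes "l \<in> log_class t" "t \<ge> 0" "norm z < 1"
  shows "(norm (l z))\<^sup>2 * (1 - (norm z)\<^sup>2) + 2 * t * (1 + (norm z)\<^sup>2) * Re (l z) + t\<^sup>2 * (1 - (norm z)\<^sup>2) \<le> 0"
  using herglotz_disc log_classD[OF assms(1)] assms(2,3) by blast

text \<open>Dropping the last, nonnegative term of the disc inequality leaves |l|^2 (1 - |z|^2)
  \<le> 4 t |l|. Linearity in \<open>t\<close> controls short steps; uniformity in |z| \<le> a
  supplies the local bounds for Montel's theorem.\<close>

lemma log_class_norm_bound:
  assumes l: "l \<in> log_class t" and t: "t \<ge> 0" and z: "norm z \<le> a" and a: "a < 1"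
  shows "norm (l z) \<le> t * (4 / (1 - a\<^sup>2))"
proof -
  let ?r = "norm z" and ?x = "norm (l z)"
  have z1: "?r < 1" using z a by simp
  have r1: "?r\<^sup>2 < 1" using z1 by (simp add: power_less_one_iff)
  have "?x\<^sup>2 * (1 - ?r\<^sup>2) \<le> 2 * t * (1 + ?r\<^sup>2) * (- Re (l z))"
    using log_class_disc[OF l t z1] r1 zero_le_mult_iff[of "t\<^sup>2" "1 - ?r\<^sup>2"] zero_le_power2[of t]
    by linarith
  also have "\<dots> \<le> 2 * t * (1 + 1) * ?x"
    using t r1 abs_Re_le_cmod[of "l z"] log_classD(3)[OF l z1]
    by (intro mult_mono add_mono mult_left_mono) auto
  finally have "?x * (?x * (1 - ?r\<^sup>2)) \<le> ?x * (4 * t)" by (simp add: power2_eq_square algebra_simps)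
  then have 1: "?x * (1 - ?r\<^sup>2) \<le> 4 * t"
    by (cases "?x = 0") (use t in \<open>auto simp: mult_le_cancel_left\<close>)
  have a1: "1 - a\<^sup>2 > 0" using a z norm_ge_zero[of z] by (simp add: power_less_one_iff abs_square_less_1 del: norm_ge_zero)
  have "?x * (1 - a\<^sup>2) \<le> ?x * (1 - ?r\<^sup>2)"
    using z power_mono[OF z norm_ge_zero, of 2] by (intro mult_left_mono) auto
  with 1 show ?thesis using a1 by (simp add: divide_simps)
qed

lemma log_class_0:
  assumes "l \<in> log_class 0" "norm z < 1" shows "l z = 0"
  using log_class_norm_bound[OF assms(1) _ order_refl assms(2)] by simp

text \<open>Montel's theorem is applied to the logarithms, not to the maps. The limit map
  \<open>z * exp (l z)\<close> is then never constant, so Hurwitz's theorem always yields its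
  injectivity.\<close>

lemma log_class_compact:
  assumes l: "\<And>n. L n \<in> log_class (t n)" and t: "\<And>n. 0 \<le> t n" "\<And>n. t n \<le> T"
  obtains r l s where "strict_mono (r :: nat \<Rightarrow> nat)" "l \<in> log_class s" "(\<lambda>n. t (r n)) \<longlonglongrightarrow> s"
    "\<And>z. norm z < 1 \<Longrightarrow> (\<lambda>n. L (r n) z) \<longlonglongrightarrow> l z"
proof -
  have bd: "\<exists>B. \<forall>h\<in>range L. \<forall>z\<in>K. norm (h z) \<le> B" if K: "compact K" "K \<subseteq> ball 0 1" for K
  proof -
    obtain a where a: "a < 1" "\<And>z. z \<in> K \<Longrightarrow> norm z \<le> a"
    proof (cases "K = {}")
      case True then show ?thesis using that[of 0] by auto
    next
      case False
      then obtain x where "x \<in> K" "\<forall>y\<in>K. norm y \<le> norm x"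
        using continuous_attains_sup[OF K(1) False, of norm] by (auto intro: continuous_intros)
      then show ?thesis using that[of "norm x"] K(2) by auto
    qed
    have "norm (L n z) \<le> T * (4 / (1 - a\<^sup>2))" if z: "z \<in> K" for n z
    proof -
      have "a\<^sup>2 \<le> 1" using a z norm_ge_zero[of z] by (smt (verit) power_le_one)
      then show ?thesis
      using log_class_norm_bound[OF l t(1) a(2)[OF z] a(1), of n] t(2)[of n]
        mult_right_mono[of "t n" T "4 / (1 - a\<^sup>2)"] by simp
    qed
    then show ?thesis by blast
  qed
  obtain l r where hl: "l holomorphic_on ball 0 1" and r: "strict_mono (r :: nat \<Rightarrow> nat)"
    and lim: "\<And>x. x \<in> ball 0 1 \<Longrightarrow> (\<lambda>n. L (r n) x) \<longlonglongrightarrow> l x"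
    and ul: "\<And>K. compact K \<Longrightarrow> K \<subseteq> ball 0 1 \<Longrightarrow> uniform_limit K (L \<circ> r) l sequentially"
  proof (rule Montel[of "ball 0 1" "range L" L])
    show "h holomorphic_on ball 0 1" if "h \<in> range L" for h
      using log_classD(1)[OF l] that by auto
    show "\<exists>B. \<forall>h\<in>range L. \<forall>z\<in>K. norm (h z) \<le> B" if "compact K" "K \<subseteq> ball 0 1" for K
      using bd[OF that] .
  qed auto
  have "(\<lambda>n. L (r n) 0) \<longlonglongrightarrow> l 0" using lim by simp
  then have c0: "(\<lambda>n. - complex_of_real (t (r n))) \<longlonglongrightarrow> l 0"
    using log_classD(2)[OF l] by simp
  define s where "s = - Re (l 0)"
  have ts: "(\<lambda>n. t (r n)) \<longlonglongrightarrow> s"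
    using tendsto_minus[OF tendsto_Re[OF c0]] by (simp add: s_def)
  then have "(\<lambda>n. - complex_of_real (t (r n))) \<longlonglongrightarrow> - complex_of_real s"
    by (intro tendsto_intros)
  then have l0: "l 0 = - complex_of_real s" using c0 LIMSEQ_unique by blast
  have re: "Re (l z) \<le> 0" if "z \<in> ball 0 1" for z
    using tendsto_Re[OF lim[OF that]] log_classD(3)[OF l] that
    by (intro LIMSEQ_le_const2[of "\<lambda>n. Re (L (r n) z)"]) auto
  have holf: "(\<lambda>z. z * exp (l z)) holomorphic_on ball 0 1"
    using hl by (intro holomorphic_intros)
  have inj: "inj_on (\<lambda>z. z * exp (l z)) (ball 0 1)"
  proof (rule Hurwitz_injective[where \<F> = "\<lambda>n z. z * exp (L (r n) z)"])
    show "(\<lambda>z. z * exp (L (r n) z)) holomorphic_on ball 0 1" for n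
      using log_classD(1)[OF l] by (intro holomorphic_intros)
    show "\<not> (\<lambda>z. z * exp (l z)) constant_on ball 0 1"
    proof
      assume "(\<lambda>z. z * exp (l z)) constant_on ball 0 1"
      then obtain c where "\<And>z. z \<in> ball 0 1 \<Longrightarrow> z * exp (l z) = c" by (auto simp: constant_on_def)
      from this[of 0] this[of "1/2"] show False by simp
    qed
    show "inj_on (\<lambda>z. z * exp (L (r n) z)) (ball 0 1)" for n
      using log_classD(4)[OF l] .
    show "uniform_limit K (\<lambda>n z. z * exp (L (r n) z)) (\<lambda>z. z * exp (l z)) sequentially"
      if K: "compact K" "K \<subseteq> ball 0 1" for K
    proof -
      have u: "uniform_limit K (\<lambda>n. L (r n)) l sequentially" using ul[OF K] by (simp add: o_def)
      have cl: "continuous_on K l" using hl K holomorphic_on_imp_continuous_on holomorphic_on_subset by blast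
      obtain B where B: "\<forall>h\<in>range L. \<forall>z\<in>K. norm (h z) \<le> B" using bd[OF K] by blast
      have "uniformly_continuous_on (cball 0 B) (exp :: complex \<Rightarrow> complex)"
        by (intro compact_uniformly_continuous continuous_intros) auto
      then have ue: "uniform_limit K (\<lambda>n z. exp (L (r n) z)) (\<lambda>z. exp (l z)) sequentially"
        using B by (intro uniform_limit_compose_uniformly_continuous_on[OF u, where B = "cball 0 B"]) auto
      have "bounded ((\<lambda>z. exp (l z)) ` K)"
        using compact_continuous_image[of K "\<lambda>z. exp (l z)"] K(1) cl compact_imp_bounded
        by (auto intro!: continuous_intros)
      moreover have "bounded ((\<lambda>z. z) ` K)" using K(1) compact_imp_bounded by auto
      ultimately show ?thesis
        by (intro uniform_lim_mult uniform_limit_const ue) (auto intro: uniform_limit_const)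
    qed
  qed (use holf in auto)
  have "l \<in> log_class s" using hl l0 re inj by (auto simp: log_class_def)
  then show ?thesis using that r ts lim by (metis mem_ball_0)
qed

section \<open>Splitting off an outer factor\<close>

text \<open>A Riemann map is corrected on the disc side: an automorphism moves the preimage of
  \<open>0\<close> to \<open>0\<close>, and a rotation by the phase \<open>u\<close> makes the
  derivative positive.\<close>

lemma normalized_Riemann_map:
  assumes W: "open W" "simply_connected W" "0 \<in> W" "W \<noteq> UNIV"
  obtains g k d where "g holomorphic_on ball 0 1" "k holomorphic_on W"
    "g ` ball 0 1 \<subseteq> W" "k ` W \<subseteq> ball 0 1"
    "\<And>z. z \<in> ball 0 1 \<Longrightarrow> k (g z) = z" "\<And>w. w \<in> W \<Longrightarrow> g (k w) = w" "g 0 = 0"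
    "d > 0" "deriv g 0 = complex_of_real d"
proof -
  obtain F G where FG: "F holomorphic_on W" "G holomorphic_on ball 0 1"
    "\<forall>z\<in>W. F z \<in> ball 0 1 \<and> G (F z) = z" "\<forall>z\<in>ball 0 1. G z \<in> W \<and> F (G z) = z"
    using Riemann_mapping_theorem[of W] W by auto
  have a: "F 0 \<in> ball 0 1" using FG W by blast
  obtain m n where m: "m (F 0) = 0" "m holomorphic_on ball 0 1" "m ` ball 0 1 \<subseteq> ball 0 1"
    and n: "n holomorphic_on ball 0 1" "n ` ball 0 1 \<subseteq> ball 0 1"
    and mn: "\<And>z. z \<in> ball 0 1 \<Longrightarrow> m (n z) = z" "\<And>z. z \<in> ball 0 1 \<Longrightarrow> n (m z) = z"
    using ball_biholomorphism_exists[OF a] by metis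
  define g0 where "g0 = G \<circ> n"
  define k0 where "k0 = m \<circ> F"
  have hg0: "g0 holomorphic_on ball 0 1"
    unfolding g0_def using n FG by (intro holomorphic_on_compose_gen[of n _ G "ball 0 1"]) auto
  have hk0: "k0 holomorphic_on W"
    unfolding k0_def using m FG by (intro holomorphic_on_compose_gen[of F _ m "ball 0 1"]) auto
  have g0W: "g0 z \<in> W" "k0 (g0 z) = z" if "z \<in> ball 0 1" for z
  proof -
    have "n z \<in> ball 0 1" using n that by blast
    then show "g0 z \<in> W" "k0 (g0 z) = z" using FG mn that by (auto simp: g0_def k0_def)
  qed
  have k0W: "k0 w \<in> ball 0 1" "g0 (k0 w) = w" if "w \<in> W" for w
  proof -
    have "F w \<in> ball 0 1" using FG that by blast
    then show "k0 w \<in> ball 0 1" "g0 (k0 w) = w" using FG mn m that by (auto simp: g0_def k0_def image_subset_iff)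
  qed
  have g00: "g0 0 = 0" using k0W(2)[OF W(3)] m(1) by (simp add: k0_def)
  have inj: "inj_on g0 (ball 0 1)" by (metis g0W(2) inj_onI)
  have dn: "deriv g0 0 \<noteq> 0"
    using holomorphic_injective_imp_regular[OF hg0 _ inj, of 0] by simp
  define u where "u = sgn (deriv g0 0)"
  have u: "norm u = 1" using dn by (simp add: u_def norm_sgn)
  have uu: "cnj u * u = 1" "u * cnj u = 1"
    using u complex_norm_square[of u] by (simp_all add: mult.commute)
  have ub: "cnj u * z \<in> ball 0 1 \<longleftrightarrow> z \<in> ball 0 1" "u * z \<in> ball 0 1 \<longleftrightarrow> z \<in> ball 0 1" for z
    using u by (simp_all add: norm_mult)
  have du: "deriv g0 0 = of_real (norm (deriv g0 0)) * u"
    using dn by (simp add: u_def sgn_eq)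
  show ?thesis
  proof (rule that[of "\<lambda>z. g0 (cnj u * z)" "\<lambda>w. u * k0 w" "norm (deriv g0 0)"])
    show "(\<lambda>z. g0 (cnj u * z)) holomorphic_on ball 0 1"
    proof -
      have "(g0 \<circ> (\<lambda>z. cnj u * z)) holomorphic_on ball 0 1"
        using ub by (intro holomorphic_on_compose_gen[OF _ hg0] holomorphic_intros) auto
      then show ?thesis by (simp add: o_def)
    qed
    show "(\<lambda>w. u * k0 w) holomorphic_on W" using hk0 by (intro holomorphic_intros)
    have "((\<lambda>z. g0 (cnj u * z)) has_field_derivative deriv g0 0 * cnj u) (at 0)"
      using holomorphic_derivI[OF hg0, of 0]
      by (intro DERIV_chain'[of "\<lambda>z. cnj u * z" "cnj u" 0 UNIV g0]) (auto intro!: derivative_eq_intros)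
    then show "deriv (\<lambda>z. g0 (cnj u * z)) 0 = complex_of_real (norm (deriv g0 0))"
      using du uu by (metis DERIV_imp_deriv mult.assoc mult.right_neutral)
    show "u * k0 (g0 (cnj u * z)) = z" if "z \<in> ball 0 1" for z
      using g0W(2)[of "cnj u * z"] ub that uu by (simp flip: mult.assoc)
    show "g0 (cnj u * (u * k0 w)) = w" if "w \<in> W" for w
      using k0W that uu by (simp flip: mult.assoc)
  qed (use g0W k0W ub g00 dn in auto)
qed

text \<open>Between the unit circle and the whole complement of the image of \<open>f\<close> there is an intermediate
  continuum close to the circle; cutting it out of the disc leaves a domain strictly between the
  image and the disc.\<close>

lemma univalent_small_factor:
  assumes f: "f \<in> univalent_class t" and t: "t > 0" and e: "e > 0"
  obtains s g h where "0 < s" "s \<le> e" "g \<in> univalent_class s"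
    "h holomorphic_on ball 0 1" "h ` ball 0 1 \<subseteq> ball 0 1" "h 0 = 0"
    "\<And>z. norm z < 1 \<Longrightarrow> g (h z) = f z"
proof -
  have hf: "f holomorphic_on ball 0 1" and inj: "inj_on f (ball 0 1)"
    and sub: "f ` ball 0 1 \<subseteq> ball 0 1" and f0: "f 0 = 0"
    and d: "deriv f 0 = complex_of_real (exp (- t))"
    using f by (auto simp: univalent_class_def)
  define U where "U = f ` ball 0 1"
  have oU: "open U" unfolding U_def by (rule open_mapping_thm3[OF hf _ inj]) auto
  obtain k where hk: "k holomorphic_on U" and dk: "\<And>z. z \<in> ball 0 1 \<Longrightarrow> deriv f z * deriv k (f z) = 1"
    and kf: "\<And>z. z \<in> ball 0 1 \<Longrightarrow> k (f z) = z"
    using holomorphic_has_inverse[OF hf _ inj] unfolding U_def by auto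
  have "ball (0::complex) 1 homeomorphic U"
    unfolding homeomorphic_def homeomorphism_def
    by (rule exI[of _ f], rule exI[of _ k])
      (use hf hk kf in \<open>auto simp: U_def holomorphic_on_imp_continuous_on image_comp\<close>)
  then have scU: "simply_connected U"
    using homeomorphic_simply_connected_eq convex_imp_simply_connected[OF convex_ball] by metis
  have UB: "U \<subseteq> ball 0 1" using sub by (simp add: U_def)
  have bU: "bounded U" using UB bounded_ball bounded_subset by blast
  have coU: "connected U" "connected (- U)"
    using simply_connected_iff_simple[OF oU bU] scU by auto
  have U0: "0 \<in> U" using f0 by (force simp: U_def)
  \<comment> \<open>Otherwise Schwarz's lemma for the inverse \<open>k\<close> contradicts
    \<open>deriv k 0 = exp t > 1\<close>.\<close>
  have Une: "U \<noteq> ball 0 1"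
  proof
    assume U: "U = ball 0 1"
    have "norm (deriv k 0) \<le> 1"
    proof (rule Schwarz_Lemma(2)[of k 0])
      show "norm (k z) < 1" if "norm z < 1" for z
        using that U kf unfolding U_def by (metis (no_types, lifting) imageE mem_ball_0)
      show "k 0 = 0" using kf[of 0] f0 by simp
    qed (use hk U in auto)
    moreover have "exp (- t) * norm (deriv k 0) = 1"
      using arg_cong[OF dk[of 0], of norm] d f0 by (simp add: norm_mult)
    ultimately have "1 \<le> exp (- t) * 1" using mult_left_mono[of "norm (deriv k 0)" 1 "exp (- t)"] by simp
    then show False using t by simp
  qed
  \<comment> \<open>\<open>W\<close> will contain the disc of radius \<open>\<rho>\<close>, which
    forces the derivative \<open>c\<close> of its Riemann map to be at least
    \<open>exp (- e)\<close>, that is \<open>s \<le> e\<close>.\<close>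
  define \<rho> where "\<rho> = exp (- e)"
  have \<rho>: "0 < \<rho>" "\<rho> < 1" using e by (simp_all add: \<rho>_def)
  let ?K = "- U \<inter> cball 0 1"
  have conK: "connected ?K"
  proof -
    \<comment> \<open>\<open>- U\<close> is connected but unbounded. The nearest-point retraction
      carries it continuously onto \<open>?K\<close>, since points outside the closed disc land on
      the unit circle and so outside \<open>U\<close>.\<close>
    have "closest_point (cball 0 1) ` (- U) = ?K"
    proof safe
      fix x assume x: "x \<notin> U"
      show "closest_point (cball 0 1) x \<in> cball 0 1"
        by (rule closest_point_in_set) auto
      assume c: "closest_point (cball 0 1) x \<in> U"
      show False
      proof (cases "x \<in> cball 0 1")
        case True then show ?thesis using c x closest_point_self by metis
      next
        case False
        then have "x \<notin> rel_interior (cball 0 1)"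
          using rel_interior_subset by blast
        then have "closest_point (cball 0 1) x \<notin> rel_interior (cball 0 1)"
          using closest_point_in_rel_interior[of "cball 0 1" x]
          by (simp add: affine_hull_nonempty_interior)
        moreover have "rel_interior (cball 0 1) = ball (0::complex) 1"
          by (simp add: rel_interior_nonempty_interior)
        ultimately have "closest_point (cball 0 1) x \<notin> ball 0 1" by simp
        then show False using c UB by auto
      qed
    next
      fix x :: complex assume "x \<notin> U" "x \<in> cball 0 1"
      then show "x \<in> closest_point (cball 0 1) ` (- U)"
        using closest_point_self[of x "cball 0 1"] by (metis ComplI image_eqI)
    qed
    moreover have "connected (closest_point (cball 0 1) ` (- U))"
      using coU(2) by (intro connected_continuous_image continuous_on_closest_point) auto
    ultimately show ?thesis by simp
  qed
  have comK: "compact ?K" using oU by (intro closed_Int_compact) auto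
  have sK: "sphere 0 1 \<subseteq> ?K" using UB by auto
  \<comment> \<open>The circle is a proper subcontinuum of the continuum \<open>?K\<close>, so a
    strictly larger continuum exists inside any neighbourhood of it. Strictness yields a point
    \<open>p\<close> of the disc that is cut out, hence \<open>s > 0\<close>; the neighbourhood
    avoiding \<open>cball 0 \<rho>\<close> yields \<open>s \<le> e\<close>.\<close>
  obtain D where D: "compact D" "connected D" "sphere 0 1 \<subset> D" "D \<subseteq> ?K \<inter> - cball 0 \<rho>"
  proof -
    have 1: "connected_space (top_of_set ?K)" using conK by (metis connectedin_def connectedin_iff_connected)
    have 2: "locally_compact_space (top_of_set ?K)"
      using comK by (intro compact_imp_locally_compact_space compact_space_subtopology) (simp add: compactin_euclidean_iff)
    have 3: "Hausdorff_space (top_of_set ?K)" by (simp add: Hausdorff_space_subtopology)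
    have 4: "compactin (top_of_set ?K) (sphere 0 1)" using sK by (simp add: compactin_subtopology)
    have 5: "connectedin (top_of_set ?K) (sphere 0 1)"
      using sK connected_sphere[of "0::complex" 1] by (simp add: connectedin_subtopology)
    have 6: "sphere (0::complex) 1 \<noteq> {}" by simp
    have 7: "sphere 0 1 \<noteq> topspace (top_of_set ?K)"
    proof
      assume "sphere 0 1 = topspace (top_of_set ?K)"
      then have "ball 0 1 \<subseteq> U" by force
      then show False using UB Une by blast
    qed
    have 8: "openin (top_of_set ?K) (?K \<inter> - cball 0 \<rho>)" by (rule openin_open_Int) auto
    have 9: "sphere 0 1 \<subseteq> ?K \<inter> - cball 0 \<rho>" using sK \<rho> by auto
    show ?thesis
      using intermediate_continuum_exists[OF 1 2 3 4 5 6 7 8 9] that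
      by (metis compactin_subtopology compactin_euclidean_iff connectedin_subtopology
          connectedin_iff_connected psubset_imp_subset)
  qed
  define K' where "K' = D \<union> - ball 0 1"
  have "connected (- ball (0::complex) 1)"
    by (intro connected_complement_bounded_convex) auto
  moreover have "D \<inter> - ball 0 1 \<noteq> {}"
  proof -
    have "(1::complex) \<in> sphere 0 1" by simp
    then have "(1::complex) \<in> D \<inter> - ball 0 1" using psubset_imp_subset[OF D(3)] by fastforce
    then show ?thesis by blast
  qed
  ultimately have conK': "connected K'"
    unfolding K'_def using D(2) by (intro connected_Un) auto
  have cK': "closed K'" unfolding K'_def using compact_imp_closed[OF D(1)] by (intro closed_Un) auto
  define W where "W = connected_component_set (- K') 0"
  have nK: "0 \<in> - K'" using D(4) \<rho> by (auto simp: K'_def)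
  have oW: "open W" unfolding W_def using cK' by (intro open_connected_component) auto
  have W0: "0 \<in> W" unfolding W_def using nK by simp
  have WB: "W \<subseteq> ball 0 1" unfolding W_def
    using connected_component_subset[of "- K'" 0] by (auto simp: K'_def)
  have UW: "U \<subseteq> W" unfolding W_def
    using U0 coU(1) UB D(4) by (intro connected_component_maximal) (auto simp: K'_def)
  have rW: "ball 0 \<rho> \<subseteq> W" unfolding W_def
    using \<rho> D(4) by (intro connected_component_maximal) (auto simp: K'_def)
  obtain p where p: "p \<in> ball 0 1" "p \<notin> W"
  proof -
    obtain p where p: "p \<in> D" "p \<notin> sphere 0 1" using D(3) by blast
    moreover have "p \<in> cball 0 1" using p D(4) by blast
    moreover have "p \<notin> W" unfolding W_def
      using connected_component_subset[of "- K'" 0] p by (auto simp: K'_def)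
    ultimately show ?thesis by (intro that[of p]) auto
  qed
  have bW: "bounded W" using WB bounded_ball bounded_subset by blast
  \<comment> \<open>A component of the complement of the connected set \<open>K'\<close> has
    connected complement; for a bounded connected open set this means simple connectivity.\<close>
  have "connected (- W)"
    using conK' by (rule component_complement_connected) (use nK in \<open>simp add: W_def componentsI\<close>)
  then have scW: "simply_connected W"
    using simply_connected_iff_simple[OF oW bW] by (simp add: W_def)
  have "W \<noteq> UNIV" using p by blast
  then obtain g k' c where g: "g holomorphic_on ball 0 1" "g ` ball 0 1 \<subseteq> W"
    and k': "k' holomorphic_on W" "k' ` W \<subseteq> ball 0 1"
    and kg: "\<And>z. z \<in> ball 0 1 \<Longrightarrow> k' (g z) = z" and gk: "\<And>w. w \<in> W \<Longrightarrow> g (k' w) = w"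
    and g0: "g 0 = 0" and c: "c > 0" "deriv g 0 = complex_of_real c"
    using normalized_Riemann_map[OF oW scW W0] by metis
  have g1: "norm (g z) < 1" if "norm z < 1" for z using g(2) WB that by fastforce
  have "c \<le> 1" using Schwarz_Lemma(2)[OF g(1) g0 g1, of 0] c by simp
  \<comment> \<open>Equality in Schwarz's lemma would make \<open>g\<close> a rotation, whose image
    contains \<open>p\<close>.\<close>
  moreover have "c \<noteq> 1"
  proof
    assume "c = 1"
    then obtain \<alpha> where \<alpha>: "\<And>z. norm z < 1 \<Longrightarrow> g z = \<alpha> * z" "norm \<alpha> = 1"
      using Schwarz_Lemma(3)[OF g(1) g0 g1, of 0] c by auto
    have n: "norm (p / \<alpha>) < 1" using p \<alpha> by (simp add: norm_divide)
    then have "g (p / \<alpha>) \<in> W" using g(2) by auto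
    moreover have "g (p / \<alpha>) = p" using \<alpha>(1)[OF n] \<alpha>(2) by auto
    ultimately show False using p by simp
  qed
  ultimately have c1: "c < 1" by simp
  \<comment> \<open>Schwarz's lemma for the rescaled inverse \<open>?q\<close> bounds
    \<open>deriv k' 0\<close> by \<open>1 / \<rho>\<close>, while the chain rule gives
    \<open>deriv k' 0 = 1 / c\<close>.\<close>
  have cr: "\<rho> \<le> c"
  proof -
    let ?q = "\<lambda>z. k' (of_real \<rho> * z)"
    have im: "of_real \<rho> * z \<in> W" if "norm z < 1" for z
    proof -
      have "norm (of_real \<rho> * z) < \<rho>" using that \<rho> by (simp add: norm_mult)
      then show ?thesis using rW by auto
    qed
    have hq: "?q holomorphic_on ball 0 1"
    proof -
      have "(k' \<circ> (\<lambda>z. of_real \<rho> * z)) holomorphic_on ball 0 1"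
        using im by (intro holomorphic_on_compose_gen[OF _ k'(1)] holomorphic_intros) auto
      then show ?thesis by (simp add: o_def)
    qed
    have k0: "k' 0 = 0" using kg[of 0] g0 by simp
    have dk: "(k' has_field_derivative deriv k' 0) (at 0)"
      using holomorphic_derivI[OF k'(1) oW W0] .
    have "(?q has_field_derivative deriv k' 0 * of_real \<rho>) (at 0)"
      by (rule DERIV_chain'[of "\<lambda>z. of_real \<rho> * z" "of_real \<rho>" 0 UNIV k'])
        (use dk in \<open>auto intro!: derivative_eq_intros\<close>)
    then have dq: "deriv ?q 0 = deriv k' 0 * of_real \<rho>" by (rule DERIV_imp_deriv)
    have q1: "norm (deriv ?q 0) \<le> 1"
      by (rule Schwarz_Lemma(2)[OF hq, of 0]) (use k0 im k'(2) in \<open>auto simp: image_subset_iff\<close>)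
    have "((\<lambda>z. k' (g z)) has_field_derivative deriv k' 0 * of_real c) (at 0)"
      by (rule DERIV_chain'[of g "of_real c" 0 UNIV k'])
        (use dk g0 c holomorphic_derivI[OF g(1), of 0] in auto)
    moreover have "((\<lambda>z. k' (g z)) has_field_derivative 1) (at 0)"
      by (rule has_field_derivative_transform_within_open[of "\<lambda>z. z" _ _ "ball 0 1"]) (use kg in auto)
    ultimately have "deriv k' 0 * of_real c = 1" using DERIV_unique by blast
    then have "norm (deriv k' 0) * c = 1" using c by (metis norm_mult norm_of_real norm_one abs_of_pos)
    moreover have "norm (deriv k' 0) * \<rho> \<le> 1" using q1 \<rho> by (simp add: dq norm_mult)
    then have "norm (deriv k' 0) * \<rho> * c \<le> 1 * c" using c by (intro mult_right_mono) auto
    ultimately show ?thesis by (simp add: mult_ac)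
  qed
  have injg: "inj_on g (ball 0 1)" by (metis kg inj_onI)
  have fW: "f z \<in> W" if "norm z < 1" for z using UW that by (auto simp: U_def)
  show ?thesis
  proof (rule that[of "- ln c" g "k' \<circ> f"])
    show "0 < - ln c" using c c1 by simp
    have "ln \<rho> \<le> ln c" using cr \<rho> c by simp
    then show "- ln c \<le> e" by (simp add: \<rho>_def)
    show "g \<in> univalent_class (- ln c)"
      using g injg g0 c g1 by (auto simp: univalent_class_def)
    show "k' \<circ> f holomorphic_on ball 0 1"
      using fW by (intro holomorphic_on_compose_gen[OF hf k'(1)]) auto
    show "(k' \<circ> f) ` ball 0 1 \<subseteq> ball 0 1" using fW k'(2) by auto
    show "(k' \<circ> f) 0 = 0" using f0 kg[of 0] g0 by simp
    show "g ((k' \<circ> f) z) = f z" if "norm z < 1" for z using gk[OF fW[OF that]] by simp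
  qed
qed

section \<open>The growth estimate\<close>

text \<open>Differences of \<open>cpot\<close> and \<open>rpot\<close> are the centre and the radius of the extremal disc.\<close>

definition cpot :: "real \<Rightarrow> real" where "cpot x = - ln (1 - x\<^sup>2)"

definition rpot :: "real \<Rightarrow> real" where "rpot x = 2 * artanh x"

lemma cpot_deriv:
  assumes "\<bar>x\<bar> < 1" shows "(cpot has_real_derivative 2 * x / (1 - x\<^sup>2)) (at x)"
  unfolding cpot_def[abs_def] using assms
  by (auto intro!: derivative_eq_intros simp: abs_square_less_1)

lemma rpot_deriv:
  assumes "\<bar>x\<bar> < 1" shows "(rpot has_real_derivative 2 / (1 - x\<^sup>2)) (at x)"
  unfolding rpot_def[abs_def] using assms
  by (auto intro!: derivative_eq_intros)

text \<open>First-order expansion in the variable log r: the mean value theorem for x \<mapsto> F (r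
  exp (-x)), with an error made uniform by the uniform continuity of \<open>x * F' x\<close> on
  \<open>{0..a}\<close>.\<close>

lemma log_increment:
  fixes F F' :: "real \<Rightarrow> real"
  assumes F: "\<And>x. 0 \<le> x \<Longrightarrow> x \<le> a \<Longrightarrow> (F has_real_derivative F' x) (at x)"
    and F': "continuous_on {0..a} F'" and a: "a < 1" and e: "e > 0"
  obtains d where "d > 0"
    "\<And>r v. 0 \<le> r \<Longrightarrow> r \<le> a \<Longrightarrow> 0 \<le> v \<Longrightarrow> v \<le> d \<Longrightarrow>
       \<bar>F r - F (r * exp (- v)) - v * (r * F' r)\<bar> \<le> e * v"
proof -
  have "uniformly_continuous_on {0..a} (\<lambda>x. x * F' x)"
    using F' by (intro compact_uniformly_continuous continuous_intros) auto
  then obtain d where d: "d > 0"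
    "\<And>x y. x \<in> {0..a} \<Longrightarrow> y \<in> {0..a} \<Longrightarrow> dist y x < d \<Longrightarrow> dist (y * F' y) (x * F' x) < e"
    unfolding uniformly_continuous_on_def using e by metis
  show ?thesis
  proof (rule that[of "d / 2"])
    fix r v :: real assume r: "0 \<le> r" "r \<le> a" and v: "0 \<le> v" "v \<le> d / 2"
    have in_a: "0 \<le> r * exp (- x)" "r * exp (- x) \<le> a" if "0 \<le> x" for x
      using r that mult_left_le[of "exp (- x)" r] by auto
    show "\<bar>F r - F (r * exp (- v)) - v * (r * F' r)\<bar> \<le> e * v"
    proof (cases "v = 0")
      case False
      then have v0: "0 < v" using v by simp
      have der: "((\<lambda>x. F (r * exp (- x))) has_real_derivative - (r * exp (- x) * F' (r * exp (- x)))) (at x)"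
        if "0 \<le> x" for x
      proof -
        have "((\<lambda>x. r * exp (- x)) has_real_derivative - (r * exp (- x))) (at x)"
          by (auto intro!: derivative_eq_intros)
        from DERIV_chain2[OF F[OF in_a[OF that]] this] show ?thesis by (simp add: mult.commute)
      qed
      obtain \<xi> where \<xi>: "0 < \<xi>" "\<xi> < v"
        and eq: "F (r * exp (- v)) - F (r * exp (- 0)) = (v - 0) * - (r * exp (- \<xi>) * F' (r * exp (- \<xi>)))"
        using MVT2[OF v0 der] by metis
      have "r * (1 - exp (- \<xi>)) \<le> 1 * \<xi>"
        using r a \<xi> exp_ge_add_one_self[of "- \<xi>"] by (intro mult_mono) auto
      moreover have "0 \<le> r * (1 - exp (- \<xi>))" using r \<xi> by simp
      ultimately have "dist (r * exp (- \<xi>)) r < d"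
        using \<xi> v by (simp add: dist_real_def algebra_simps)
      then have b: "\<bar>r * exp (- \<xi>) * F' (r * exp (- \<xi>)) - r * F' r\<bar> < e"
        using d(2)[of r "r * exp (- \<xi>)"] in_a[of \<xi>] r \<xi> by (simp add: dist_real_def)
      have "F r - F (r * exp (- v)) - v * (r * F' r) = v * (r * exp (- \<xi>) * F' (r * exp (- \<xi>)) - r * F' r)"
        using eq by (simp add: algebra_simps)
      then have "\<bar>F r - F (r * exp (- v)) - v * (r * F' r)\<bar> = v * \<bar>r * exp (- \<xi>) * F' (r * exp (- \<xi>)) - r * F' r\<bar>"
        using v0 by (simp add: abs_mult)
      also have "\<dots> \<le> v * e" using b v0 by (intro mult_left_mono) auto
      finally show ?thesis by (simp add: mult.commute)
    qed simp
  qed (use d in simp)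
qed

text \<open>The coefficients of \<open>v\<close> are the centre and the radius of the disc for an
  infinitesimal step that lowers log |z| by \<open>v\<close>.\<close>

lemma pot_increment:
  assumes a: "0 < a" "a < 1" and e: "e > 0"
  obtains d where "d > 0"
    "\<And>r v. 0 \<le> r \<Longrightarrow> r \<le> a \<Longrightarrow> 0 \<le> v \<Longrightarrow> v \<le> d \<Longrightarrow>
       \<bar>cpot r - cpot (r * exp (- v)) - v * (2 * r\<^sup>2 / (1 - r\<^sup>2))\<bar> \<le> e * v"
    "\<And>r v. 0 \<le> r \<Longrightarrow> r \<le> a \<Longrightarrow> 0 \<le> v \<Longrightarrow> v \<le> d \<Longrightarrow>
       \<bar>rpot r - rpot (r * exp (- v)) - v * (2 * r / (1 - r\<^sup>2))\<bar> \<le> e * v"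
proof -
  have ne: "1 - x\<^sup>2 \<noteq> 0" if "0 \<le> x" "x \<le> a" for x
    using that a abs_square_less_1[of x] by auto
  obtain d1 where d1: "d1 > 0"
    "\<And>r v. 0 \<le> r \<Longrightarrow> r \<le> a \<Longrightarrow> 0 \<le> v \<Longrightarrow> v \<le> d1 \<Longrightarrow>
       \<bar>cpot r - cpot (r * exp (- v)) - v * (r * (2 * r / (1 - r\<^sup>2)))\<bar> \<le> e * v"
    by (rule log_increment[of a cpot "\<lambda>x. 2 * x / (1 - x\<^sup>2)" e])
      (use a e ne in \<open>auto intro!: cpot_deriv continuous_intros\<close>)
  obtain d2 where d2: "d2 > 0"
    "\<And>r v. 0 \<le> r \<Longrightarrow> r \<le> a \<Longrightarrow> 0 \<le> v \<Longrightarrow> v \<le> d2 \<Longrightarrow>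
       \<bar>rpot r - rpot (r * exp (- v)) - v * (r * (2 / (1 - r\<^sup>2)))\<bar> \<le> e * v"
    by (rule log_increment[of a rpot "\<lambda>x. 2 / (1 - x\<^sup>2)" e])
      (use a e ne in \<open>auto intro!: rpot_deriv continuous_intros\<close>)
  show ?thesis
    by (rule that[of "min d1 d2"]) (use d1 d2 in \<open>auto simp: power2_eq_square mult_ac\<close>)
qed

text \<open>Nonpositive exactly when \<open>t + l z\<close> lies in the closed extremal disc
  belonging to the moduli of \<open>z\<close> and of its image.\<close>

definition excess :: "real \<Rightarrow> (complex \<Rightarrow> complex) \<Rightarrow> complex \<Rightarrow> real" where
  "excess t l z =
     norm (of_real t + l z - of_real (cpot (norm z) - cpot (norm (z * exp (l z)))))
     - (rpot (norm z) - rpot (norm (z * exp (l z))))"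

text \<open>Centre and radius are differences of potentials and telescope, which leaves the triangle
  inequality.\<close>

lemma excess_compose:
  "excess (s + t) (\<lambda>z. l1 z + l2 (z * exp (l1 z))) z \<le> excess s l1 z + excess t l2 (z * exp (l1 z))"
proof -
  let ?w = "z * exp (l1 z)"
  have e: "z * exp (l1 z + l2 ?w) = ?w * exp (l2 ?w)" by (simp add: exp_add)
  have "of_real (s + t) + (l1 z + l2 ?w) - of_real (cpot (norm z) - cpot (norm (?w * exp (l2 ?w)))) =
     (of_real s + l1 z - of_real (cpot (norm z) - cpot (norm ?w))) +
     (of_real t + l2 ?w - of_real (cpot (norm ?w) - cpot (norm (?w * exp (l2 ?w)))))"
    by simp
  then have "norm (of_real (s + t) + (l1 z + l2 ?w) - of_real (cpot (norm z) - cpot (norm (?w * exp (l2 ?w)))))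
    \<le> norm (of_real s + l1 z - of_real (cpot (norm z) - cpot (norm ?w))) +
      norm (of_real t + l2 ?w - of_real (cpot (norm ?w) - cpot (norm (?w * exp (l2 ?w)))))"
    by (metis norm_triangle_ineq)
  then show ?thesis unfolding excess_def e by linarith
qed

lemma log_class_tendsto_norm:
  assumes lim: "(\<lambda>n. L n z) \<longlonglongrightarrow> l z" and l: "l \<in> log_class s" and z: "norm z < 1"
  shows "(\<lambda>n. cpot (norm (z * exp (L n z)))) \<longlonglongrightarrow> cpot (norm (z * exp (l z)))"
    "(\<lambda>n. rpot (norm (z * exp (L n z)))) \<longlonglongrightarrow> rpot (norm (z * exp (l z)))"
proof -
  have w: "\<bar>norm (z * exp (l z))\<bar> < 1" using norm_times_exp_le[OF l z] z by simp
  have t: "(\<lambda>n. norm (z * exp (L n z))) \<longlonglongrightarrow> norm (z * exp (l z))"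
    using lim by (intro tendsto_intros)
  show "(\<lambda>n. cpot (norm (z * exp (L n z)))) \<longlonglongrightarrow> cpot (norm (z * exp (l z)))"
    using DERIV_isCont[OF cpot_deriv[OF w]] t isCont_tendsto_compose by blast
  show "(\<lambda>n. rpot (norm (z * exp (L n z)))) \<longlonglongrightarrow> rpot (norm (z * exp (l z)))"
    using DERIV_isCont[OF rpot_deriv[OF w]] t isCont_tendsto_compose by blast
qed

lemma excess_tendsto:
  assumes "(\<lambda>n. L n z) \<longlonglongrightarrow> l z" "(\<lambda>n. t n) \<longlonglongrightarrow> s" "l \<in> log_class s" "norm z < 1"
  shows "(\<lambda>n. excess (t n) (L n) z) \<longlonglongrightarrow> excess s l z"
  unfolding excess_def
  using assms log_class_tendsto_norm[where L = L and z = z and l = l, OF assms(1,3,4)]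
  by (intro tendsto_intros)

text \<open>With the potentials replaced by their linear parts, the excess is nonpositive by the
  Schwarz disc alone. Only the two expansion errors remain; they are small multiples of the loss
  \<open>v\<close>, itself at most \<open>K * t\<close>.\<close>

lemma excess_small_step:
  assumes a: "0 < a" "a < 1" and e: "e > 0"
  obtains d where "d > 0"
    "\<And>t l z. 0 \<le> t \<Longrightarrow> t \<le> d \<Longrightarrow> l \<in> log_class t \<Longrightarrow> norm z \<le> a \<Longrightarrow> excess t l z \<le> e * t"
proof -
  define K where "K = 4 / (1 - a\<^sup>2)"
  have K: "K > 0" using a by (simp add: K_def abs_square_less_1)
  obtain d where d: "d > 0"
    "\<And>r v. 0 \<le> r \<Longrightarrow> r \<le> a \<Longrightarrow> 0 \<le> v \<Longrightarrow> v \<le> d \<Longrightarrow>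
       \<bar>cpot r - cpot (r * exp (- v)) - v * (2 * r\<^sup>2 / (1 - r\<^sup>2))\<bar> \<le> e / (2 * K) * v"
    "\<And>r v. 0 \<le> r \<Longrightarrow> r \<le> a \<Longrightarrow> 0 \<le> v \<Longrightarrow> v \<le> d \<Longrightarrow>
       \<bar>rpot r - rpot (r * exp (- v)) - v * (2 * r / (1 - r\<^sup>2))\<bar> \<le> e / (2 * K) * v"
    using pot_increment[OF a, of "e / (2 * K)"] e K by (metis divide_pos_pos mult_pos_pos zero_less_numeral)
  show ?thesis
  proof (rule that[of "d / K"])
    fix t l and z :: complex
    assume t: "0 \<le> t" "t \<le> d / K" and l: "l \<in> log_class t" and z: "norm z \<le> a"
    define r where "r = norm z"
    define v where "v = - Re (l z)"
    define y where "y = Im (l z)"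
    define q where "q = 1 - r\<^sup>2"
    have r: "0 \<le> r" "r \<le> a" using z by (auto simp: r_def)
    have z1: "norm z < 1" using z a by simp
    have q: "q > 0" using r a by (simp add: q_def abs_square_less_1)
    have v0: "0 \<le> v" using log_classD(3)[OF l z1] by (simp add: v_def)
    have vK: "v \<le> t * K"
      using log_class_norm_bound[OF l t(1) z a(2)] abs_Re_le_cmod[of "l z"] by (simp add: v_def K_def)
    then have vd: "v \<le> d" using t K by (simp add: field_simps)
    have w: "norm (z * exp (l z)) = r * exp (- v)" by (simp add: norm_mult r_def v_def)
    have n2: "(norm (l z))\<^sup>2 = v\<^sup>2 + y\<^sup>2" by (simp add: cmod_power2 v_def y_def)
    have her: "(v\<^sup>2 + y\<^sup>2) * q + 2 * t * (2 - q) * (- v) + t\<^sup>2 * q \<le> 0"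
      using log_class_disc[OF l t(1) z1] unfolding n2[symmetric] by (simp add: q_def r_def v_def)
    define m where "m = v * (2 * r\<^sup>2 / (1 - r\<^sup>2))"
    have r2: "r\<^sup>2 = 1 - q" by (simp add: q_def)
    \<comment> \<open>An exact identity: the quadratic form in \<open>her\<close> with the square
      completed in \<open>t\<close> for fixed \<open>v\<close>, so that centre and radius become
      multiples of \<open>v\<close>.\<close>
    have "(t - v - m)\<^sup>2 + y\<^sup>2 - (v * (2 * r / (1 - r\<^sup>2)))\<^sup>2 =
        ((v\<^sup>2 + y\<^sup>2) * q + 2 * t * (2 - q) * (- v) + t\<^sup>2 * q) / q"
      unfolding m_def power_mult_distrib power_divide r2 using q
      by (simp add: field_simps power2_eq_square)
    also have "\<dots> \<le> 0" using her q by (simp add: divide_le_0_iff)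
    finally have "(t - v - m)\<^sup>2 + y\<^sup>2 \<le> (v * (2 * r / (1 - r\<^sup>2)))\<^sup>2" by simp
    then have main: "norm (of_real t + l z - of_real m) \<le> v * (2 * r / (1 - r\<^sup>2))"
      using v0 r q unfolding cmod_def by (intro real_le_lsqrt) (auto simp: v_def y_def q_def divide_le_0_iff mult_le_0_iff)
    have "norm (of_real t + l z - of_real (cpot r - cpot (r * exp (- v)))) \<le>
      norm (of_real t + l z - of_real m) + norm (complex_of_real (cpot r - cpot (r * exp (- v)) - m))"
      using norm_triangle_ineq4[of "of_real t + l z - of_real m" "complex_of_real (cpot r - cpot (r * exp (- v)) - m)"]
      by (simp add: algebra_simps)
    also have "\<dots> \<le> v * (2 * r / (1 - r\<^sup>2)) + e / (2 * K) * v"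
      unfolding norm_of_real using main d(2)[OF r v0 vd] by (simp add: m_def)
    finally have "excess t l z \<le> 2 * (e / (2 * K) * v)"
      unfolding excess_def w r_def[symmetric] using d(3)[OF r v0 vd] by linarith
    also have "\<dots> \<le> 2 * (e / (2 * K) * (t * K))"
      using vK e K by (intro mult_left_mono) auto
    also have "\<dots> = e * t" using K by simp
    finally show "excess t l z \<le> e * t" .
  qed (use d K in auto)
qed

lemma log_class_small_factor:
  assumes l: "l \<in> log_class t" and t: "t > 0" and e: "e > 0"
  obtains s l1 l2 where "0 < s" "s \<le> e" "s \<le> t" "l1 \<in> log_class (t - s)" "l2 \<in> log_class s"
    "\<And>z. norm z < 1 \<Longrightarrow> l z = l1 z + l2 (z * exp (l1 z))"
proof -
  let ?f = "\<lambda>z. z * exp (l z)"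
  obtain s g h where s: "0 < s" "s \<le> e" and g: "g \<in> univalent_class s"
    and h: "h holomorphic_on ball 0 1" "h ` ball 0 1 \<subseteq> ball 0 1" "h 0 = 0"
    and gh: "\<And>z. norm z < 1 \<Longrightarrow> g (h z) = ?f z"
    using univalent_small_factor[OF log_imp_univalent_class[OF l t] t e] by metis
  obtain l2 where l2: "l2 \<in> log_class s" and gl: "\<And>z. norm z < 1 \<Longrightarrow> g z = z * exp (l2 z)"
    using univalent_class_imp_log[OF g] by metis
  define l1 where "l1 z = l z - l2 (h z)" for z
  have h1: "norm (h z) < 1" if "norm z < 1" for z using h(2) that by (auto simp: image_subset_iff)
  have hz: "h z = z * exp (l1 z)" if z: "norm z < 1" for z
    using gh[OF z] gl[OF h1[OF z]] by (simp add: l1_def exp_diff field_simps)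
  have hle: "norm (h z) \<le> norm z" if "norm z < 1" for z
    using Schwarz_Lemma(1)[OF h(1,3) h1 that] .
  have hl1: "l1 holomorphic_on ball 0 1"
    unfolding l1_def[abs_def]
    using log_classD(1)[OF l] holomorphic_on_compose_gen[OF h(1) log_classD(1)[OF l2] h(2)]
    by (intro holomorphic_intros) (auto simp: o_def)
  have l10: "l1 0 = - complex_of_real (t - s)"
    using h(3) log_classD(2)[OF l] log_classD(2)[OF l2] by (simp add: l1_def)
  have re': "Re (l1 z) \<le> 0" if "norm z < 1" "z \<noteq> 0" for z
  proof -
    have "norm z * exp (Re (l1 z)) \<le> norm z * 1"
      using hle[OF that(1)] by (simp add: hz[OF that(1)] norm_mult)
    then show ?thesis using that by simp
  qed
  \<comment> \<open>Division by |z| fails at the origin, so continuity is used there. As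
    \<open>l1 0 = s - t\<close>, this also gives \<open>s \<le> t\<close>.\<close>
  have re0: "Re (l1 0) \<le> 0"
  proof -
    have "isCont l1 0" using hl1 holomorphic_on_imp_continuous_on[of l1 "ball 0 1"]
      by (simp add: continuous_on_eq_continuous_at)
    then have "((\<lambda>z. Re (l1 z)) \<longlongrightarrow> Re (l1 0)) (at 0)" by (intro tendsto_Re) (simp add: isCont_def)
    moreover have "\<forall>\<^sub>F z in at 0. Re (l1 z) \<le> 0"
      unfolding eventually_at using re' by (intro exI[of _ 1]) (auto simp: dist_norm)
    ultimately show ?thesis by (intro tendsto_upperbound) auto
  qed
  have re: "Re (l1 z) \<le> 0" if "norm z < 1" for z using re' re0 that by (cases "z = 0") auto
  have st: "s \<le> t" using re0 l10 by simp
  have "inj_on (\<lambda>z. z * exp (l1 z)) (ball 0 1)"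
  proof (rule inj_onI)
    fix x y assume xy: "x \<in> ball 0 1" "y \<in> ball 0 1" "x * exp (l1 x) = y * exp (l1 y)"
    then have "?f x = ?f y" using hz gh by (metis mem_ball_0)
    then show "x = y" using log_classD(4)[OF l] xy by (auto dest: inj_onD)
  qed
  then have "l1 \<in> log_class (t - s)" using hl1 l10 re by (auto simp: log_class_def)
  moreover have "l z = l1 z + l2 (z * exp (l1 z))" if "norm z < 1" for z
    using hz[OF that] by (simp add: l1_def)
  ultimately show ?thesis using that s st l2 by metis
qed

text \<open>If \<^term>\<open>excess\<close> were positive at some \<^term>\<open>l\<close>, it would exceed
  \<open>e * t + d\<close> with \<open>d > 0\<close> there. Among all such violators one with the least \<open>t\<close> exists by
  compactness; splitting off a short outer factor from it yields a smaller one.\<close>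

theorem excess_nonpos:
  assumes l: "l \<in> log_class T" and T: "T \<ge> 0" and z: "norm z < 1"
  shows "excess T l z \<le> 0"
proof (rule ccontr)
  assume "\<not> ?thesis"
  then have pos: "excess T l z > 0" by simp
  \<comment> \<open>Half of the excess goes into the slope \<open>e\<close>, half into the offset
    \<open>d\<close>. The offset rules out violators with \<open>t = 0\<close>; the slope pays for
    the factor that is split off.\<close>
  define e where "e = excess T l z / (2 * (T + 1))"
  define d where "d = excess T l z / 2"
  have e: "e > 0" and d: "d > 0" using pos T by (simp_all add: e_def d_def)
  have "e * T \<le> excess T l z / 2" using pos T by (simp add: e_def field_simps)
  then have viol: "excess T l z \<ge> e * T + d" by (simp add: d_def)
  define a where "a = (norm z + 1) / 2"
  have a: "0 < a" "a < 1" "norm z \<le> a" using z add_nonneg_pos[OF norm_ge_zero[of z] zero_less_one] by (auto simp: a_def)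
  define M where "M = {t. 0 \<le> t \<and> t \<le> T \<and> (\<exists>l\<in>log_class t. excess t l z \<ge> e * t + d)}"
  have TM: "T \<in> M" using l T viol by (auto simp: M_def)
  have bM: "bdd_below M" by (auto simp: M_def bdd_below_def)
  have "\<exists>t\<in>M. t < Inf M + 1 / (real n + 1)" for n
    using cInf_lessD[of M "Inf M + 1 / (real n + 1)"] TM by (auto simp: add_pos_nonneg)
  then obtain t where t: "\<And>n. t n \<in> M" "\<And>n. t n < Inf M + 1 / (real n + 1)" by metis
  have lim: "t \<longlonglongrightarrow> Inf M"
  proof (rule tendsto_sandwich[of "\<lambda>_. Inf M" _ _ "\<lambda>n. Inf M + 1 / (real n + 1)"])
    show "(\<lambda>n. Inf M + 1 / (real n + 1)) \<longlonglongrightarrow> Inf M"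
      using tendsto_add[OF tendsto_const LIMSEQ_inverse_real_of_nat, of "Inf M"]
      by (simp add: inverse_eq_divide add.commute)
    show "\<forall>\<^sub>F n in sequentially. Inf M \<le> t n" using cInf_lower[OF t(1) bM] by simp
    show "\<forall>\<^sub>F n in sequentially. t n \<le> Inf M + 1 / (real n + 1)" using less_imp_le[OF t(2)] by (intro always_eventually allI)
  qed simp
  have "\<forall>n. \<exists>l. l \<in> log_class (t n) \<and> excess (t n) l z \<ge> e * t n + d"
    using t(1) by (auto simp: M_def)
  then obtain L where L: "\<And>n. L n \<in> log_class (t n)" "\<And>n. excess (t n) (L n) z \<ge> e * t n + d" by metis
  have t0T: "0 \<le> t n" "t n \<le> T" for n using t(1) by (auto simp: M_def)
  obtain r k s where r: "strict_mono (r :: nat \<Rightarrow> nat)" and k: "k \<in> log_class s"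
    and ts: "(\<lambda>n. t (r n)) \<longlonglongrightarrow> s" and Lk: "\<And>z. norm z < 1 \<Longrightarrow> (\<lambda>n. L (r n) z) \<longlonglongrightarrow> k z"
    using log_class_compact[of L t T] L(1) t0T by metis
  have s: "s = Inf M" using LIMSEQ_subseq_LIMSEQ[OF lim r] ts LIMSEQ_unique by (auto simp: o_def)
  have s0: "0 \<le> s" "s \<le> T" using t0T ts by (auto intro: LIMSEQ_le_const LIMSEQ_le_const2)
  have ks: "excess s k z \<ge> e * s + d"
  proof (rule LIMSEQ_le[of "\<lambda>n. e * t (r n) + d" _ "\<lambda>n. excess (t (r n)) (L (r n)) z"])
    show "(\<lambda>n. e * t (r n) + d) \<longlonglongrightarrow> e * s + d" using ts by (intro tendsto_intros)
    show "(\<lambda>n. excess (t (r n)) (L (r n)) z) \<longlonglongrightarrow> excess s k z"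
      using excess_tendsto[of "\<lambda>n. L (r n)" z k "\<lambda>n. t (r n)", OF Lk ts k] z by simp
    show "\<exists>N. \<forall>n\<ge>N. e * t (r n) + d \<le> excess (t (r n)) (L (r n)) z" using L(2) by blast
  qed
  show False
  proof (cases "s = 0")
    case True
    then have "k z = 0" using k log_class_0 z by simp
    then have "excess s k z = 0" using True by (simp add: excess_def)
    then show False using ks True d by simp
  next
    case False
    then have s1: "s > 0" using s0 by simp
    obtain \<delta> where \<delta>: "\<delta> > 0" "\<And>t l z. 0 \<le> t \<Longrightarrow> t \<le> \<delta> \<Longrightarrow> l \<in> log_class t \<Longrightarrow> norm z \<le> a \<Longrightarrow> excess t l z \<le> e * t"
      using excess_small_step[OF a(1,2) e] by metis
    obtain u l1 l2 where u: "0 < u" "u \<le> \<delta>" "u \<le> s" and l1: "l1 \<in> log_class (s - u)" and l2: "l2 \<in> log_class u"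
      and kz: "\<And>z. norm z < 1 \<Longrightarrow> k z = l1 z + l2 (z * exp (l1 z))"
      using log_class_small_factor[OF k s1 \<delta>(1)] by metis
    \<comment> \<open>The short factor is the outer one and acts at \<open>?w\<close>, whose modulus
      is still at most \<open>a\<close>; so \<open>\<delta>\<close> could be fixed before
      factoring.\<close>
    let ?w = "z * exp (l1 z)"
    have "excess s k z = excess ((s - u) + u) (\<lambda>z. l1 z + l2 (z * exp (l1 z))) z"
      using kz[OF z] by (simp add: excess_def)
    also have "\<dots> \<le> excess (s - u) l1 z + excess u l2 ?w" by (rule excess_compose)
    also have "excess u l2 ?w \<le> e * u"
      using \<delta>(2)[OF _ u(2) l2] u norm_times_exp_le[OF l1 z] a(3) by simp
    finally have "excess (s - u) l1 z \<ge> e * (s - u) + d" using ks by (simp add: algebra_simps)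
    then have "s - u \<in> M" using l1 u s0 by (auto simp: M_def)
    then have "Inf M \<le> s - u" using cInf_lower bM by blast
    then show False using s u by simp
  qed
qed

section \<open>Attaining prescribed values\<close>

text \<open>A single exponential step in place of the flow with velocity - z p(z).
  \<open>Re p \<ge> 0\<close> keeps the image in the disc. For univalence, equal values at
  \<open>x\<close> and \<open>y\<close> give |x - y| = |y| |exp u - 1| with u = s (p(x) - p(y)),
  which is at most 3/16 |x - y|.\<close>

lemma moebius_log_class:
  assumes g: "0 \<le> g" "g < 1"
  obtains d where "d > 0"
    "\<And>s \<gamma>. 0 \<le> s \<Longrightarrow> s \<le> d \<Longrightarrow> norm \<gamma> \<le> g \<Longrightarrow>
       (\<lambda>z. - of_real s * ((1 + \<gamma> * z) / (1 - \<gamma> * z))) \<in> log_class s"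
\<comment> \<open>\<open>2 / (1 - g)^2\<close> is a Lipschitz constant of \<open>p\<close> on the
  disc, so this choice gives |u| \<le> |x - y| / 8, within the range where |exp u - 1| \<le> 3/2
  |u|.\<close>
proof (rule that[of "(1 - g)\<^sup>2 / 16"])
  show "0 < (1 - g)\<^sup>2 / 16" using g by simp
  fix s :: real and \<gamma> :: complex assume s: "0 \<le> s" "s \<le> (1 - g)\<^sup>2 / 16" and \<gamma>: "norm \<gamma> \<le> g"
  let ?p = "\<lambda>z. (1 + \<gamma> * z) / (1 - \<gamma> * z)"
  have gz: "norm (\<gamma> * z) \<le> g" if "norm z < 1" for z
    using that \<gamma> g mult_mono[of "norm \<gamma>" g "norm z" 1] by (simp add: norm_mult)
  have den: "norm (1 - \<gamma> * z) \<ge> 1 - g" if "norm z < 1" for z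
    using gz[OF that] norm_triangle_ineq2[of 1 "\<gamma> * z"] by simp
  have ne: "1 - \<gamma> * z \<noteq> 0" if "norm z < 1" for z
    using den[OF that] g by auto
  have re: "Re (?p z) \<ge> 0" if "norm z < 1" for z
  proof -
    let ?\<zeta> = "\<gamma> * z"
    have "(norm ?\<zeta>)\<^sup>2 \<le> 1" using gz[OF that] g by (simp add: power_le_one)
    then have "Re ((1 + ?\<zeta>) * cnj (1 - ?\<zeta>)) \<ge> 0"
      unfolding cmod_power2 by (simp add: power2_eq_square algebra_simps)
    then show ?thesis by (subst complex_div_cnj) (simp add: Re_divide_of_real flip: of_real_power)
  qed
  have "inj_on (\<lambda>z. z * exp (- of_real s * ?p z)) (ball 0 1)"
  proof (rule inj_onI, rule ccontr)
    fix x y assume xy: "x \<in> ball 0 1" "y \<in> ball 0 1" "x * exp (- of_real s * ?p x) = y * exp (- of_real s * ?p y)"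
      and neq: "x \<noteq> y"
    let ?u = "of_real s * (?p x - ?p y)"
    have "x = y * exp (- of_real s * ?p y) / exp (- of_real s * ?p x)"
      using xy(3) by (simp add: eq_divide_eq)
    also have "\<dots> = y * exp (- of_real s * ?p y - - of_real s * ?p x)"
      by (simp only: exp_diff times_divide_eq_right)
    also have "- of_real s * ?p y - - of_real s * ?p x = ?u"
      by (simp only: right_diff_distrib mult_minus_left) simp
    finally have xe: "x - y = y * (exp ?u - 1)" by (simp add: algebra_simps)
    have "?p x - ?p y = 2 * \<gamma> * (x - y) / ((1 - \<gamma> * x) * (1 - \<gamma> * y))"
      using ne[of x] ne[of y] xy by (simp add: field_simps)
    then have "norm ?u = s * (2 * norm \<gamma> * norm (x - y) / (norm (1 - \<gamma> * x) * norm (1 - \<gamma> * y)))"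
      using s by (simp add: norm_mult norm_divide)
    also have "\<dots> \<le> s * (2 * 1 * norm (x - y) / ((1 - g) * (1 - g)))"
      using s den[of x] den[of y] xy \<gamma> g
      by (intro mult_left_mono frac_le mult_mono) (auto intro!: mult_pos_pos mult_nonneg_nonneg)
    also have "\<dots> \<le> (1 - g)\<^sup>2 / 16 * (2 * 1 * norm (x - y) / ((1 - g) * (1 - g)))"
      using s by (intro mult_right_mono) auto
    also have "\<dots> = norm (x - y) / 8"
    proof -
      have "G\<^sup>2 / 16 * (2 * 1 * n / (G * G)) = n / 8" if "G \<noteq> 0" for G n :: real
        using that by (simp add: power2_eq_square)
      then show ?thesis using g by simp
    qed
    finally have u: "norm ?u \<le> norm (x - y) / 8" .
    have "norm (x - y) \<le> 2" using norm_triangle_ineq4[of x y] xy by simp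
    then have "norm ?u \<le> 1 / 2" using u by simp
    then have "norm (exp ?u - 1) \<le> 3 / 2 * norm ?u" by (rule norm_exp_bounds)
    then have "norm y * norm (exp ?u - 1) \<le> 1 * (3 / 2 * norm ?u)"
      using xy by (intro mult_mono) auto
    moreover have "norm (x - y) > 0" using neq by simp
    moreover have "norm (x - y) = norm y * norm (exp ?u - 1)" by (subst xe) (rule norm_mult)
    ultimately show False using u by linarith
  qed
  moreover have "(\<lambda>z. - of_real s * ?p z) holomorphic_on ball 0 1"
    using ne by (intro holomorphic_intros) auto
  moreover have "Re (- of_real s * ?p z) \<le> 0" if "norm z < 1" for z
  proof -
    have "Re (- of_real s * ?p z) = - (s * Re (?p z))"
      by (simp only: mult_minus_left uminus_complex.sel Re_complex_of_real complex.sel times_complex.sel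
          Im_complex_of_real mult_zero_left diff_zero)
    then show ?thesis using s(1) re[OF that] mult_nonneg_nonneg[OF s(1) re[OF that]] by linarith
  qed
  ultimately show "(\<lambda>z. - of_real s * ?p z) \<in> log_class s"
    unfolding log_class_def by simp
qed

text \<open>Distance of \<open>t + l z\<close> from the point at relative position
  \<open>- c\<close> in the extremal disc. For a fixed \<open>c\<close> both potential terms
  telescope under composition.\<close>

definition defect :: "complex \<Rightarrow> real \<Rightarrow> (complex \<Rightarrow> complex) \<Rightarrow> complex \<Rightarrow> real" where
  "defect c t l z =
     norm (of_real t + l z - of_real (cpot (norm z) - cpot (norm (z * exp (l z))))
       + c * of_real (rpot (norm z) - rpot (norm (z * exp (l z)))))"

lemma defect_compose:
  "defect c (s + t) (\<lambda>z. l1 z + l2 (z * exp (l1 z))) z \<le> defect c s l1 z + defect c t l2 (z * exp (l1 z))"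
proof -
  let ?w = "z * exp (l1 z)"
  have e: "z * exp (l1 z + l2 ?w) = ?w * exp (l2 ?w)" by (simp add: exp_add)
  have "of_real (s + t) + (l1 z + l2 ?w) - of_real (cpot (norm z) - cpot (norm (?w * exp (l2 ?w))))
       + c * of_real (rpot (norm z) - rpot (norm (?w * exp (l2 ?w)))) =
     (of_real s + l1 z - of_real (cpot (norm z) - cpot (norm ?w)) + c * of_real (rpot (norm z) - rpot (norm ?w))) +
     (of_real t + l2 ?w - of_real (cpot (norm ?w) - cpot (norm (?w * exp (l2 ?w))))
        + c * of_real (rpot (norm ?w) - rpot (norm (?w * exp (l2 ?w)))))"
    by (simp add: algebra_simps)
  then show ?thesis unfolding defect_def e by (metis norm_triangle_ineq)
qed

lemma defect_tendsto:
  assumes "(\<lambda>n. L n z) \<longlonglongrightarrow> l z" "t \<longlonglongrightarrow> s" "c \<longlonglongrightarrow> c'" "l \<in> log_class s" "norm z < 1"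
  shows "(\<lambda>n. defect (c n) (t n) (L n) z) \<longlonglongrightarrow> defect c' s l z"
  unfolding defect_def
  using assms log_class_tendsto_norm[where L = L and z = z and l = l, OF assms(1,4,5)]
  by (intro tendsto_intros)

lemma Moebius_denominator_nonzero:
  fixes r :: real
  assumes c: "norm c < 1" and r: "0 \<le> r" "r \<le> 1"
  shows "1 - cnj c * of_real r \<noteq> 0"
proof
  assume "1 - cnj c * of_real r = 0"
  then have "norm (cnj c * of_real r) = 1" by (simp flip: eq_iff_diff_eq_0)
  moreover have "norm (cnj c * of_real r) \<le> norm c * 1"
    using r by (simp add: norm_mult mult_left_le)
  ultimately show False using c by simp
qed

text \<open>A flow with velocity \<open>- w p\<close> changes \<open>log w + t\<close> by \<open>(1 - p) dt\<close> and \<open>log |w|\<close> by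
  \<open>- Re p dt\<close>. The parameter \<open>\<gamma>\<close> solves the linear equation for \<open>p\<close> under which \<open>log w + t\<close> moves like
  \<open>cpot\<close> minus \<open>c\<close> times \<open>rpot\<close>, so that \<open>c\<close> is the position in the extremal disc.\<close>

lemma steering_value:
  fixes c :: complex and r :: real
  assumes c: "norm c < 1" and r: "0 \<le> r" "r < 1"
  defines "\<gamma> \<equiv> - Moebius_function 0 c (of_real r)"
  defines "q \<equiv> (1 - r\<^sup>2) / (1 + r\<^sup>2 - 2 * r * Re c)"
  shows "Re ((1 + \<gamma> * of_real r) / (1 - \<gamma> * of_real r)) = q"
    "1 - (1 + \<gamma> * of_real r) / (1 - \<gamma> * of_real r) =
       of_real (q * (2 * r\<^sup>2 / (1 - r\<^sup>2))) - c * of_real (q * (2 * r / (1 - r\<^sup>2)))"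
    "0 \<le> q" "q \<le> (1 + r) / (1 - r)"
proof -
  define D where "D = 1 + r\<^sup>2 - 2 * r * Re c"
  have "r * Re c \<le> r * norm c" using r complex_Re_le_cmod by (intro mult_left_mono) auto
  also have "\<dots> \<le> r * 1" using r c by (intro mult_left_mono) auto
  finally have D2: "(1 - r)\<^sup>2 \<le> D" by (simp add: D_def power2_eq_square algebra_simps)
  have r1: "(1 - r)\<^sup>2 > 0" using r by (intro zero_less_power) simp
  note D = less_le_trans[OF r1 D2] D2
  have r2: "1 - r\<^sup>2 > 0" using r by (simp add: abs_square_less_1)
  show "0 \<le> q" unfolding q_def D_def[symmetric] using D r2 by simp
  have "(1 - r\<^sup>2) / D \<le> (1 - r\<^sup>2) / (1 - r)\<^sup>2"
    by (rule divide_left_mono[OF D(2) less_imp_le[OF r2] mult_pos_pos[OF D(1) r1]])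
  also have "\<dots> = (1 + r) / (1 - r)"
  proof -
    have "1 - r\<^sup>2 = (1 + r) * (1 - r)" by (simp add: power2_eq_square algebra_simps)
    then show ?thesis using r by (simp add: power2_eq_square)
  qed
  finally show "q \<le> (1 + r) / (1 - r)" unfolding q_def D_def[symmetric] .
  note m = Moebius_denominator_nonzero[OF c r(1) less_imp_le[OF r(2)]]
  have \<gamma>: "\<gamma> = (c - of_real r) / (1 - cnj c * of_real r)"
    unfolding \<gamma>_def Moebius_function_simple by (simp add: minus_divide_left)
  have cc: "c + cnj c = of_real (2 * Re c)" by (simp add: complex_add_cnj)
  have num: "1 + \<gamma> * of_real r = (1 - of_real (r\<^sup>2) + of_real r * (c - cnj c)) / (1 - cnj c * of_real r)"
    unfolding \<gamma> using m by (simp add: field_simps power2_eq_square)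
  have "1 - \<gamma> * of_real r = (1 + of_real (r\<^sup>2) - of_real r * (c + cnj c)) / (1 - cnj c * of_real r)"
    unfolding \<gamma> using m by (simp add: field_simps power2_eq_square)
  then have den: "1 - \<gamma> * of_real r = of_real D / (1 - cnj c * of_real r)"
    unfolding cc D_def by simp
  have p: "(1 + \<gamma> * of_real r) / (1 - \<gamma> * of_real r) = (1 - of_real (r\<^sup>2) + of_real r * (c - cnj c)) / of_real D"
    unfolding num den using m by simp
  show "Re ((1 + \<gamma> * of_real r) / (1 - \<gamma> * of_real r)) = q"
    unfolding p q_def D_def[symmetric] by (simp add: Re_divide_of_real)
  have "1 - (1 + \<gamma> * of_real r) / (1 - \<gamma> * of_real r) =
      (of_real D - (1 - of_real (r\<^sup>2) + of_real r * (c - cnj c))) / of_real D"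
    unfolding p using D by (simp add: field_simps)
  also have "of_real D = 1 + of_real (r\<^sup>2) - of_real r * (c + cnj c)"
    unfolding cc D_def by simp
  then have "of_real D - (1 - of_real (r\<^sup>2) + of_real r * (c - cnj c)) = 2 * of_real (r\<^sup>2) - 2 * of_real r * c"
    by (simp add: algebra_simps)
  also have "(2 * of_real (r\<^sup>2) - 2 * of_real r * c) / complex_of_real D = of_real (2 * r\<^sup>2 / D) - c * of_real (2 * r / D)"
    by (simp add: diff_divide_distrib)
  also have "2 * r\<^sup>2 / D = q * (2 * r\<^sup>2 / (1 - r\<^sup>2))"
    unfolding q_def D_def[symmetric] using r2 by simp
  also have "2 * r / D = q * (2 * r / (1 - r\<^sup>2))"
    unfolding q_def D_def[symmetric] using r2 by simp
  finally show "1 - (1 + \<gamma> * of_real r) / (1 - \<gamma> * of_real r) =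
       of_real (q * (2 * r\<^sup>2 / (1 - r\<^sup>2))) - c * of_real (q * (2 * r / (1 - r\<^sup>2)))" .
qed

text \<open>For \<open>norm c < 1\<close> the steering parameter stays in a compact part of the disc
  while the modulus runs over \<open>{0..a}\<close>, so one step size serves all points. Positions
  with |c| = 1 are left to a limit argument.\<close>

lemma steering_step:
  assumes c: "norm c < 1" and a: "0 < a" "a < 1" and e: "e > 0"
  obtains d where "d > 0"
    "\<And>s w. 0 \<le> s \<Longrightarrow> s \<le> d \<Longrightarrow> w \<noteq> 0 \<Longrightarrow> norm w \<le> a \<Longrightarrow>
       \<exists>l\<in>log_class s. defect c s l w \<le> e * s"
proof -
  let ?\<gamma> = "\<lambda>r. - Moebius_function 0 c (complex_of_real r)"
  have m: "1 - cnj c * of_real r \<noteq> 0" if "0 \<le> r" "r \<le> a" for r :: real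
    using Moebius_denominator_nonzero[OF c that(1)] that a by simp
  have "continuous_on {0..a} (\<lambda>r. norm (?\<gamma> r))"
    unfolding Moebius_function_simple using m by (intro continuous_intros) auto
  then obtain r0 where r0: "r0 \<in> {0..a}" "\<And>r. r \<in> {0..a} \<Longrightarrow> norm (?\<gamma> r) \<le> norm (?\<gamma> r0)"
    using continuous_attains_sup[of "{0..a}" "\<lambda>r. norm (?\<gamma> r)"] a by auto
  have g1: "norm (?\<gamma> r0) < 1"
    using Moebius_function_norm_lt_1[OF c, of "of_real r0" 0] r0 a by simp
  obtain d1 where d1: "d1 > 0"
    "\<And>s \<gamma>. 0 \<le> s \<Longrightarrow> s \<le> d1 \<Longrightarrow> norm \<gamma> \<le> norm (?\<gamma> r0) \<Longrightarrow>
       (\<lambda>z. - of_real s * ((1 + \<gamma> * z) / (1 - \<gamma> * z))) \<in> log_class s"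
    using moebius_log_class[OF norm_ge_zero g1] by metis
  define Q where "Q = (1 + a) / (1 - a)"
  have Q: "Q > 0" using a by (simp add: Q_def)
  obtain d where d: "d > 0"
    "\<And>r v. 0 \<le> r \<Longrightarrow> r \<le> a \<Longrightarrow> 0 \<le> v \<Longrightarrow> v \<le> d \<Longrightarrow>
       \<bar>cpot r - cpot (r * exp (- v)) - v * (2 * r\<^sup>2 / (1 - r\<^sup>2))\<bar> \<le> e / (2 * Q) * v"
    "\<And>r v. 0 \<le> r \<Longrightarrow> r \<le> a \<Longrightarrow> 0 \<le> v \<Longrightarrow> v \<le> d \<Longrightarrow>
       \<bar>rpot r - rpot (r * exp (- v)) - v * (2 * r / (1 - r\<^sup>2))\<bar> \<le> e / (2 * Q) * v"
    using pot_increment[OF a, of "e / (2 * Q)"] e Q by (metis divide_pos_pos mult_pos_pos zero_less_numeral)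
  show ?thesis
  proof (rule that[of "min d1 (d / Q)"])
    show "0 < min d1 (d / Q)" using d d1 Q by simp
    fix s :: real and w :: complex
    assume s: "0 \<le> s" "s \<le> min d1 (d / Q)" and w: "w \<noteq> 0" "norm w \<le> a"
    define r where "r = norm w"
    have r: "0 < r" "r \<le> a" "0 \<le> r" "r < 1" using w a by (auto simp: r_def)
    define \<gamma> where "\<gamma> = ?\<gamma> r"
    \<comment> \<open>A rotation transfers the computation at the real point \<open>r\<close> to
      \<open>w\<close>: \<open>\<gamma>' * w = \<gamma> * r\<close>.\<close>
    define \<gamma>' where "\<gamma>' = \<gamma> * cnj w / of_real r"
    define l where "l z = - of_real s * ((1 + \<gamma>' * z) / (1 - \<gamma>' * z))" for z
    have "norm \<gamma>' = norm \<gamma>" using r by (simp add: \<gamma>'_def norm_mult norm_divide r_def)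
    also have "\<dots> \<le> norm (?\<gamma> r0)" using r0(2)[of r] r by (simp add: \<gamma>_def)
    finally have l: "l \<in> log_class s" unfolding l_def[abs_def] using d1(2) s by simp
    have \<gamma>w: "\<gamma>' * w = \<gamma> * of_real r"
    proof -
      have "cnj w * w = of_real r * of_real r"
        using complex_norm_square[of w] by (simp add: r_def power2_eq_square mult.commute)
      then show ?thesis using r by (simp add: \<gamma>'_def mult.assoc)
    qed
    define p where "p = (1 + \<gamma> * of_real r) / (1 - \<gamma> * of_real r)"
    define q where "q = Re p"
    have lw: "l w = - of_real s * p" by (simp add: l_def \<gamma>w p_def)
    have q: "1 - p = of_real (q * (2 * r\<^sup>2 / (1 - r\<^sup>2))) - c * of_real (q * (2 * r / (1 - r\<^sup>2)))"
      "0 \<le> q" "q \<le> (1 + r) / (1 - r)"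
      using steering_value[OF c r(3,4)] unfolding p_def q_def \<gamma>_def by simp_all
    define v where "v = s * q"
    have qQ: "q \<le> Q"
    proof -
      have "(1 + r) / (1 - r) \<le> Q" unfolding Q_def using r a by (intro frac_le) auto
      then show ?thesis using q by simp
    qed
    have v: "0 \<le> v" "v \<le> s * Q" using s q qQ by (auto simp: v_def mult_left_mono)
    have vd: "v \<le> d" using v s Q by (simp add: field_simps)
    have rw: "norm (w * exp (l w)) = r * exp (- v)"
      by (simp add: norm_mult r_def lw v_def q_def)
    let ?H = "cpot r - cpot (r * exp (- v))" and ?R = "rpot r - rpot (r * exp (- v))"
    let ?h = "v * (2 * r\<^sup>2 / (1 - r\<^sup>2))" and ?k = "v * (2 * r / (1 - r\<^sup>2))"
    have "of_real s + l w = of_real s * (1 - p)" by (simp add: lw algebra_simps)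
    also have "\<dots> = of_real ?h - c * of_real ?k"
      unfolding q(1) v_def by (simp add: algebra_simps)
    finally have main: "of_real s + l w = of_real ?h - c * of_real ?k" .
    have "of_real s + l w - of_real ?H + c * of_real ?R = c * of_real (?R - ?k) - of_real (?H - ?h)"
      unfolding main of_real_diff right_diff_distrib by (simp only: algebra_simps)
    then have "defect c s l w = norm (c * of_real (?R - ?k) - of_real (?H - ?h))"
      unfolding defect_def rw r_def[symmetric] by (simp only:)
    also have "\<dots> \<le> norm (c * of_real (?R - ?k)) + norm (complex_of_real (?H - ?h))"
      by (rule norm_triangle_ineq4)
    also have "\<dots> = norm c * \<bar>?R - ?k\<bar> + \<bar>?H - ?h\<bar>"
      by (simp only: norm_mult norm_of_real)
    also have "\<dots> \<le> 1 * (e / (2 * Q) * v) + e / (2 * Q) * v"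
      using d(2)[OF r(3,2) v(1) vd] d(3)[OF r(3,2) v(1) vd] c by (intro add_mono mult_mono) auto
    also have "\<dots> = e / Q * v" using Q by simp
    also have "\<dots> \<le> e / Q * (s * Q)" using v e Q by (intro mult_left_mono) auto
    also have "\<dots> = e * s" using Q by simp
    finally show "\<exists>l\<in>log_class s. defect c s l w \<le> e * s" using l by blast
  qed
qed

lemma zero_in_log_class: "(\<lambda>_. 0) \<in> log_class 0"
  by (auto simp: log_class_def)

text \<open>Euler's method with \<open>n\<close> equal steps, each chosen at the current image of
  \<open>z\<close>. Moduli never grow, so the step size is uniform and the errors sum to at most
  \<open>e * T\<close>.\<close>

lemma steering_approx:
  assumes c: "norm c < 1" and z: "norm z < 1" "z \<noteq> 0" and T: "T \<ge> 0" and e: "e > 0"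
  shows "\<exists>l\<in>log_class T. defect c T l z \<le> e * T"
proof -
  obtain d where d: "d > 0"
    "\<And>s w. 0 \<le> s \<Longrightarrow> s \<le> d \<Longrightarrow> w \<noteq> 0 \<Longrightarrow> norm w \<le> norm z \<Longrightarrow>
       \<exists>l\<in>log_class s. defect c s l w \<le> e * s"
    using steering_step[OF c, of "norm z" e] z e by auto
  obtain n :: nat where n: "T / d < real n" using reals_Archimedean2 by blast
  then have n0: "n > 0" using T d by (cases n) (auto simp: divide_less_0_iff)
  define s where "s = T / n"
  have s: "0 \<le> s" "s \<le> d" using T n n0 d by (simp_all add: s_def field_simps)
  have "\<exists>l\<in>log_class (real k * s). defect c (real k * s) l z \<le> e * (real k * s)" for k
  proof (induction k)
    case 0
    show ?case using zero_in_log_class by (intro bexI[of _ "\<lambda>_. 0"]) (simp_all add: defect_def)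
  next
    case (Suc k)
    then obtain l where l: "l \<in> log_class (real k * s)" "defect c (real k * s) l z \<le> e * (real k * s)" by blast
    let ?w = "z * exp (l z)"
    obtain l2 where l2: "l2 \<in> log_class s" "defect c s l2 ?w \<le> e * s"
      using d(2)[OF s, of ?w] z norm_times_exp_le[OF l(1) z(1)] by auto
    have "defect c (real k * s + s) (\<lambda>z. l z + l2 (z * exp (l z))) z \<le> e * (real k * s + s)"
      using defect_compose[of c "real k * s" s l l2 z] l l2 by (simp add: algebra_simps)
    moreover have "real (Suc k) * s = real k * s + s" by (simp add: algebra_simps)
    ultimately show ?case using log_class_compose[OF l(1) l2(1)] by metis
  qed
  from this[of n] show ?thesis using n0 by (simp add: s_def)
qed

theorem steering_exact:
  assumes c: "norm c \<le> 1" and z: "norm z < 1" "z \<noteq> 0" and T: "T \<ge> 0"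
  obtains l where "l \<in> log_class T"
    "of_real T + l z = of_real (cpot (norm z) - cpot (norm (z * exp (l z))))
       - c * of_real (rpot (norm z) - rpot (norm (z * exp (l z))))"
proof -
  \<comment> \<open>Interior positions tending to \<open>c\<close>, paired with errors tending to
    \<open>0\<close>; one passage to the limit settles both.\<close>
  define C where "C n = of_real (real n / real (Suc n)) * c" for n :: nat
  have Cn: "norm (C n) < 1" for n
  proof -
    have "real n / real (Suc n) * norm c \<le> real n / real (Suc n) * 1" using c by (intro mult_left_mono) auto
    also have "\<dots> < 1" by simp
    finally show ?thesis unfolding C_def norm_mult norm_of_real by simp
  qed
  have "(\<lambda>n. complex_of_real (real n / real (Suc n))) \<longlonglongrightarrow> of_real 1"
    using LIMSEQ_n_over_Suc_n by (intro tendsto_of_real)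
  then have "C \<longlonglongrightarrow> of_real 1 * c" unfolding C_def[abs_def] by (intro tendsto_mult tendsto_const)
  then have Clim: "C \<longlonglongrightarrow> c" by simp
  have "\<exists>l\<in>log_class T. defect (C n) T l z \<le> inverse (real (Suc n)) * T" for n
    using steering_approx[OF Cn z T] by simp
  then obtain L where L: "\<And>n. L n \<in> log_class T" "\<And>n. defect (C n) T (L n) z \<le> inverse (real (Suc n)) * T"
    by metis
  obtain r l s where r: "strict_mono (r :: nat \<Rightarrow> nat)" and l: "l \<in> log_class s"
    and ts: "(\<lambda>n. T) \<longlonglongrightarrow> s" and lim: "\<And>z. norm z < 1 \<Longrightarrow> (\<lambda>n. L (r n) z) \<longlonglongrightarrow> l z"
    using log_class_compact[of L "\<lambda>_. T" T] L(1) T by auto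
  have sT: "s = T" using ts by (simp add: LIMSEQ_const_iff)
  have "(\<lambda>n. defect (C (r n)) T (L (r n)) z) \<longlonglongrightarrow> defect c s l z"
    using defect_tendsto[of "\<lambda>n. L (r n)" z l "\<lambda>_. T" s "\<lambda>n. C (r n)" c] lim z ts l
      LIMSEQ_subseq_LIMSEQ[OF Clim r] by (simp add: o_def)
  moreover have "(\<lambda>n. inverse (real (Suc (r n))) * T) \<longlonglongrightarrow> 0 * T"
    using LIMSEQ_subseq_LIMSEQ[OF LIMSEQ_inverse_real_of_nat r] by (intro tendsto_intros) (simp add: o_def)
  ultimately have "defect c s l z \<le> 0 * T"
    using L(2) by (intro LIMSEQ_le) auto
  then have "defect c T l z = 0" using sT by (simp add: defect_def)
  then have "of_real T + l z - of_real (cpot (norm z) - cpot (norm (z * exp (l z))))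
       + c * of_real (rpot (norm z) - rpot (norm (z * exp (l z)))) = 0" unfolding defect_def by simp
  then have "of_real T + l z = of_real (cpot (norm z) - cpot (norm (z * exp (l z))))
       - c * of_real (rpot (norm z) - rpot (norm (z * exp (l z))))" by (simp add: algebra_simps)
  then show ?thesis using that l sT by blast
qed

section \<open>Regions bounded by two arcs in polar coordinates\<close>

text \<open>The absolute value of the argument is continuous across the negative real axis, unlike
  \<^const>\<open>Arg\<close>.\<close>

definition aarg :: "complex \<Rightarrow> real" where "aarg z = arccos (Re z / norm z)"

lemma aarg_bounds: "z \<noteq> 0 \<Longrightarrow> 0 \<le> aarg z" "z \<noteq> 0 \<Longrightarrow> aarg z \<le> pi"
  using abs_Re_le_cmod[of z]
  by (auto simp: aarg_def abs_le_iff divide_simps intro!: arccos_lbound arccos_ubound)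

lemma aarg_polar:
  assumes "r > 0" shows "aarg (of_real r * exp (\<i> * of_real \<theta>)) = arccos (cos \<theta>)"
  using assms by (simp add: aarg_def norm_mult Re_exp)

lemma aarg_polar_abs:
  assumes "r > 0" "\<bar>\<theta>\<bar> \<le> pi" shows "aarg (of_real r * exp (\<i> * of_real \<theta>)) = \<bar>\<theta>\<bar>"
  using assms by (simp add: aarg_polar arccos_cos_eq_abs)

text \<open>A continued branch of the argument may wind beyond pi, and reduction modulo 2 pi can
  only lower its absolute value.\<close>

lemma aarg_polar_le:
  assumes "r > 0" shows "aarg (of_real r * exp (\<i> * of_real \<theta>)) \<le> \<bar>\<theta>\<bar>"
proof (cases "\<bar>\<theta>\<bar> \<le> pi")
  case True then show ?thesis using aarg_polar_abs[OF assms] by simp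
next
  case False
  moreover have "aarg (of_real r * exp (\<i> * of_real \<theta>)) \<le> pi"
    using assms by (intro aarg_bounds(2)) simp
  ultimately show ?thesis by linarith
qed

lemma polar_aarg:
  assumes "z \<noteq> 0"
  shows "z = of_real (norm z) * exp (\<i> * of_real (aarg z)) \<or>
         z = of_real (norm z) * exp (- \<i> * of_real (aarg z))"
proof -
  have arg: "z = of_real (norm z) * exp (\<i> * of_real (Arg z))"
    using Arg_eq[OF assms] by simp
  have "\<bar>Arg z\<bar> \<le> pi" using Arg_bounded[of z] by auto
  then have "aarg z = \<bar>Arg z\<bar>"
    using aarg_polar_abs[of "norm z" "Arg z"] assms arg by simp
  then show ?thesis using arg by (cases "Arg z \<ge> 0") auto
qed

lemma continuous_on_aarg: "continuous_on (- {0}) aarg"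
proof -
  have "-1 \<le> Re z / norm z \<and> Re z / norm z \<le> 1" if "z \<noteq> 0" for z
    using abs_Re_le_cmod[of z] that by (auto simp: abs_le_iff divide_simps)
  then show ?thesis unfolding aarg_def by (intro continuous_intros) auto
qed

lemma open_aarg_less:
  assumes "continuous_on UNIV (E :: real \<Rightarrow> real)"
  shows "open {z. z \<noteq> 0 \<and> aarg z < E (norm z)}" "open {z. z \<noteq> 0 \<and> E (norm z) < aarg z}"
proof -
  have E: "continuous_on (- {0 :: complex}) (\<lambda>z. E (norm z))"
    by (rule continuous_on_compose2[OF assms]) (auto intro: continuous_intros)
  have "continuous_on (- {0}) (\<lambda>z. E (norm z) - aarg z)"
    using E continuous_on_aarg by (intro continuous_intros)
  note op = continuous_open_preimage[OF this]
  have
    "open (- {0} \<inter> (\<lambda>z. E (norm z) - aarg z) -` {0<..})"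
    "open (- {0} \<inter> (\<lambda>z. E (norm z) - aarg z) -` {..<0})"
    by - (rule op; auto)+
  moreover have "- {0} \<inter> (\<lambda>z. E (norm z) - aarg z) -` {0<..} = {z. z \<noteq> 0 \<and> aarg z < E (norm z)}"
    "- {0} \<inter> (\<lambda>z. E (norm z) - aarg z) -` {..<0} = {z. z \<noteq> 0 \<and> E (norm z) < aarg z}"
    by auto
  ultimately show "open {z. z \<noteq> 0 \<and> aarg z < E (norm z)}" "open {z. z \<noteq> 0 \<and> E (norm z) < aarg z}"
    by simp_all
qed

lemma Jordan_curve_sides:
  assumes J: "closed_Jordan_curve J"
  shows "open (inside J)" "open (outside J)" "connected (inside J)" "connected (outside J)"
    "inside J \<inter> outside J = {}" "inside J \<union> outside J = - J" "\<not> bounded (outside J)"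
    "frontier (inside J) = J" "frontier (outside J) = J" "closed J"
proof -
  obtain g where g: "simple_path g" "pathfinish g = pathstart g" "path_image g = J"
    using J by (auto simp: closed_Jordan_curve_def)
  show "open (inside J)" "open (outside J)" "connected (inside J)" "connected (outside J)"
    "inside J \<inter> outside J = {}" "inside J \<union> outside J = - J" "\<not> bounded (outside J)"
    "frontier (inside J) = J" "frontier (outside J) = J"
    using Jordan_inside_outside[OF g(1,2)] g(3) by simp_all
  then show "closed J" using frontier_closed by metis
qed

text \<open>Open sets that partition the complement of a Jordan curve are unions of its two sides, so
  the interior is recognised without exhibiting a single path.\<close>

lemma inside_Jordan_eq:
  assumes J: "closed_Jordan_curve J" and JC: "J \<subseteq> C" and C: "open (- C)" "bounded C"
    and O: "open (C - J)" "C - J \<noteq> {}"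
  shows "inside J = C - J" "outside J = - C"
proof -
  note s = Jordan_curve_sides[OF J]
  have part: "X \<subseteq> C - J \<or> X \<subseteq> - C" if "connected X" "X \<inter> J = {}" for X
    using connectedD[OF that(1) O(1) C(1)] that(2) by blast
  have out: "outside J \<subseteq> - C"
    using part[OF s(4)] s(6,7) C(2) bounded_subset by blast
  then have "inside J \<subseteq> C - J"
    using part[OF s(3)] s(6) O(2) by blast
  then show "inside J = C - J" "outside J = - C" using out s(5,6) JC by blast+
qed

text \<open>Two arcs symmetric about the real axis. With the modulus as parameter each arc is
  visibly injective.\<close>

definition fan :: "(real \<Rightarrow> real) \<Rightarrow> real \<Rightarrow> real \<Rightarrow> complex set" where
  "fan S a b = (\<lambda>r. of_real r * exp (\<i> * of_real (S r))) ` {a..b} \<union>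
               (\<lambda>r. of_real r * exp (- \<i> * of_real (S r))) ` {a..b}"

lemma fan_eq:
  assumes a: "0 < a" and S: "\<And>r. a \<le> r \<Longrightarrow> r \<le> b \<Longrightarrow> 0 \<le> S r \<and> S r \<le> pi"
  shows "fan S a b = {z. a \<le> norm z \<and> norm z \<le> b \<and> aarg z = S (norm z)}" (is "_ = ?J")
proof
  show "fan S a b \<subseteq> ?J"
  proof
    fix z assume "z \<in> fan S a b"
    then obtain r \<theta> where r: "a \<le> r" "r \<le> b" "z = of_real r * exp (\<i> * of_real \<theta>)" "\<bar>\<theta>\<bar> = S r"
    proof -
      assume *: "\<And>r \<theta>. a \<le> r \<Longrightarrow> r \<le> b \<Longrightarrow> z = of_real r * exp (\<i> * of_real \<theta>) \<Longrightarrow> \<bar>\<theta>\<bar> = S r \<Longrightarrow> thesis"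
      from \<open>z \<in> fan S a b\<close> consider r where "r \<in> {a..b}" "z = of_real r * exp (\<i> * of_real (S r))"
        | r where "r \<in> {a..b}" "z = of_real r * exp (- \<i> * of_real (S r))"
        by (auto simp: fan_def)
      then show thesis
      proof cases
        case 1 then show ?thesis using *[of r "S r"] S[of r] by simp
      next
        case 2 then show ?thesis using *[of r "- S r"] S[of r] by simp
      qed
    qed
    moreover have "norm z = r" using r a by (simp add: norm_mult)
    moreover have "aarg z = S r" using r a S[of r] aarg_polar_abs[of r \<theta>] by simp
    ultimately show "z \<in> ?J" by simp
  qed
  show "?J \<subseteq> fan S a b"
  proof
    fix z assume z: "z \<in> ?J"
    then have "z \<noteq> 0" using a by auto
    from polar_aarg[OF this] z show "z \<in> fan S a b"
      unfolding fan_def by (auto intro!: image_eqI[of _ _ "norm z"])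
  qed
qed

text \<open>The arcs meet only where \<open>sin (S r) = 0\<close>. End values \<open>0, 0\<close>
  give the curve of cases (i) and (iii), \<open>pi, 0\<close> the outer and \<open>0, pi\<close> the
  inner curve of case (ii).\<close>

locale fan_curve =
  fixes S :: "real \<Rightarrow> real" and a b :: real
  assumes ab: "0 < a" "a < b" and cont: "continuous_on {a..b} S"
    and mid: "\<And>r. a < r \<Longrightarrow> r < b \<Longrightarrow> 0 < S r \<and> S r < pi"
    and ends: "S a \<in> {0, pi}" "S b \<in> {0, pi}"
begin

lemma S_range: "a \<le> r \<Longrightarrow> r \<le> b \<Longrightarrow> 0 \<le> S r \<and> S r \<le> pi"
  using mid[of r] ends by (cases "r = a"; cases "r = b") (auto simp: less_eq_real_def)

lemma fan_eq': "fan S a b = {z. a \<le> norm z \<and> norm z \<le> b \<and> aarg z = S (norm z)}"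
  using ab(1) S_range by (rule fan_eq)

lemma fan_Int:
  "(\<lambda>r. of_real r * exp (\<i> * of_real (S r))) ` {a..b} \<inter> (\<lambda>r. of_real r * exp (- \<i> * of_real (S r))) ` {a..b}
     = {of_real a * exp (\<i> * of_real (S a)), of_real b * exp (\<i> * complex_of_real (S b))}"
  and fan_ends: "exp (\<i> * complex_of_real (S a)) = exp (- \<i> * of_real (S a))"
    "exp (\<i> * complex_of_real (S b)) = exp (- \<i> * of_real (S b))"
proof -
  show e: "exp (\<i> * complex_of_real (S a)) = exp (- \<i> * of_real (S a))"
    "exp (\<i> * complex_of_real (S b)) = exp (- \<i> * of_real (S b))"
    using ends by (auto simp: exp_minus)
  show "(\<lambda>r. of_real r * exp (\<i> * of_real (S r))) ` {a..b} \<inter> (\<lambda>r. of_real r * exp (- \<i> * of_real (S r))) ` {a..b}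
     = {of_real a * exp (\<i> * of_real (S a)), of_real b * exp (\<i> * complex_of_real (S b))}" (is "?P \<inter> ?M = ?E")
  proof
    have "a \<in> {a..b}" "b \<in> {a..b}" using ab by auto
    then have "of_real a * exp (\<i> * of_real (S a)) \<in> ?P" "of_real b * exp (\<i> * complex_of_real (S b)) \<in> ?P"
      "of_real a * exp (- \<i> * of_real (S a)) \<in> ?M" "of_real b * exp (- \<i> * complex_of_real (S b)) \<in> ?M"
      by (blast intro: imageI)+
    then show "?E \<subseteq> ?P \<inter> ?M" using e by (simp only: insert_subset Int_iff empty_subsetI)
    show "?P \<inter> ?M \<subseteq> ?E"
    proof
      fix z assume "z \<in> ?P \<inter> ?M"
      then obtain r r' where r: "a \<le> r" "r \<le> b" "z = of_real r * exp (\<i> * of_real (S r))"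
        and r': "a \<le> r'" "r' \<le> b" "z = of_real r' * exp (- \<i> * of_real (S r'))" by auto
      have "norm z = r" using r(1) ab unfolding r(3) by (simp add: norm_mult)
      moreover have "norm z = r'" using r'(1) ab unfolding r'(3) by (simp add: norm_mult)
      ultimately have rr: "r' = r" by simp
      have "exp (\<i> * complex_of_real (S r)) = exp (- \<i> * of_real (S r))"
        using r(1,3) r'(3) ab unfolding rr by auto
      then have "Im (exp (\<i> * complex_of_real (S r))) = Im (exp (- \<i> * of_real (S r)))" by simp
      then have "sin (S r) = 0" by (simp add: Im_exp)
      then have "\<not> (a < r \<and> r < b)" using mid[of r] sin_gt_zero[of "S r"] by auto
      then have "r = a \<or> r = b" using r by auto
      then show "z \<in> ?E" using r by auto
    qed
  qed
qed

lemma Jordan: "closed_Jordan_curve (fan S a b)"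
proof -
  let ?p = "\<lambda>r. of_real r * exp (\<i> * complex_of_real (S r))"
  let ?m = "\<lambda>r. of_real r * exp (- \<i> * complex_of_real (S r))"
  have inj: "inj_on ?p {a..b}" "inj_on ?m {a..b}"
  proof -
    have "norm (?p r) = r" "norm (?m r) = r" if "r \<in> {a..b}" for r
      using that ab by (simp_all add: norm_mult)
    then show "inj_on ?p {a..b}" "inj_on ?m {a..b}"
      by (auto intro: inj_on_inverseI[where g = norm])
  qed
  have c: "continuous_on {a..b} ?p" "continuous_on {a..b} ?m"
    using cont by (intro continuous_intros; simp)+
  have seg: "closed_segment a b = {a..b}" "closed_segment b a = {a..b}"
    using ab by (auto simp: closed_segment_eq_real_ivl)
  let ?g = "?p \<circ> linepath a b" and ?h = "?m \<circ> linepath b a"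
  have arcI: "arc (f \<circ> linepath u v)" if "continuous_on {a..b} f" "inj_on f {a..b}"
    "u \<noteq> v" "closed_segment u v = {a..b}" for f :: "real \<Rightarrow> complex" and u v
    unfolding arc_def using that
    by (simp add: path_continuous_image comp_inj_on inj_on_linepath linepath_image_01)
  have arcs: "arc ?g" "arc ?h"
    using arcI[OF c(1) inj(1) _ seg(1)] arcI[OF c(2) inj(2) _ seg(2)] ab by blast+
  have im: "path_image ?g = ?p ` {a..b}" "path_image ?h = ?m ` {a..b}"
    using seg by (simp_all add: path_image_compose)
  have s: "simple_path (?g +++ ?h)"
  proof (rule simple_path_join_loop[OF arcs])
    show "path_image ?g \<inter> path_image ?h \<subseteq> {pathstart ?g, pathstart ?h}"
      unfolding im fan_Int using fan_ends by (auto simp: pathstart_compose)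
  qed (use fan_ends in \<open>simp_all add: pathstart_compose pathfinish_compose\<close>)
  have ef: "pathfinish ?g = pathstart ?h" "pathfinish ?h = pathstart ?g"
    using fan_ends by (simp_all add: pathstart_compose pathfinish_compose)
  have "path_image (?g +++ ?h) = fan S a b"
    unfolding path_image_join[OF ef(1)] im fan_def ..
  moreover have "pathfinish (?g +++ ?h) = pathstart (?g +++ ?h)" using ef by simp
  ultimately show ?thesis unfolding closed_Jordan_curve_def using s by blast
qed

text \<open>The extended angle leaves \<open>[0, \<pi>]\<close> outside \<open>[a, b]\<close>, upwards or downwards according to the signs of
  \<open>A\<close> and \<open>B\<close>, so that the sides of the curve are given by a single strict inequality.\<close>

definition ext_S :: "real \<Rightarrow> real \<Rightarrow> real \<Rightarrow> real" where
  "ext_S A B r = S (max a (min b r)) + A * max 0 (a - r) + B * max 0 (r - b)"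

lemma ext_S:
  shows "continuous_on UNIV (ext_S A B)"
    "\<And>r. a \<le> r \<Longrightarrow> r \<le> b \<Longrightarrow> ext_S A B r = S r" "\<And>r. r < a \<Longrightarrow> ext_S A B r = S a + A * (a - r)"
    "\<And>r. r > b \<Longrightarrow> ext_S A B r = S b + B * (r - b)"
proof -
  have "continuous_on UNIV (\<lambda>r. S (max a (min b r)))"
    using ab by (intro continuous_on_compose2[OF cont] continuous_intros) auto
  then show "continuous_on UNIV (ext_S A B)" unfolding ext_S_def[abs_def] by (intro continuous_intros)
qed (use ab in \<open>auto simp: ext_S_def max_def min_def\<close>)

text \<open>Both continuations of the angle drop below \<open>0\<close>, so all radii outside
  \<open>[a, b]\<close> fall on the outer side.\<close>

lemma fan_simple:
  assumes 0: "S a = 0" "S b = 0"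
  defines "C \<equiv> {z. a \<le> norm z \<and> norm z \<le> b \<and> aarg z \<le> S (norm z)}"
  shows "inside (fan S a b) = C - fan S a b" "fan S a b \<subseteq> C" "outside (fan S a b) = - C"
proof -
  define E where "E = ext_S (-1) (-1)"
  note E = ext_S[where A = "-1" and B = "-1", folded E_def]
  let ?P = "{z. z \<noteq> 0 \<and> E (norm z) < aarg z}" and ?N = "{z. z \<noteq> 0 \<and> aarg z < E (norm z)}"
  note op = open_aarg_less[OF E(1)]
  have ne: "z \<noteq> 0" if "a \<le> norm z" for z :: complex using that ab by auto
  \<comment> \<open>\<open>aarg\<close> is discontinuous at \<open>0\<close>, which
    \<open>?P\<close> and \<open>?N\<close> therefore omit; the disc puts it back.\<close>
  have "- C = ?P \<union> ball 0 a"
  proof -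
    have "z \<in> - C \<longleftrightarrow> z \<in> ?P \<union> ball 0 a" for z
      using E(2,4)[of "norm z"] ne[of z] aarg_bounds[of z] 0 ab
      by (cases "norm z < a"; cases "norm z > b") (auto simp: C_def not_less)
    then show ?thesis by blast
  qed
  then have oC: "open (- C)" using op by auto
  have "C - fan S a b = ?N"
  proof -
    have "z \<in> C - fan S a b \<longleftrightarrow> z \<in> ?N" for z
      using E(2,3,4)[of "norm z"] ne[of z] aarg_bounds[of z] 0 ab
      by (cases "z = 0"; cases "norm z < a"; cases "norm z > b") (auto simp: C_def not_less fan_eq')
    then show ?thesis by blast
  qed
  then have oN: "open (C - fan S a b)" using op by simp
  show sub: "fan S a b \<subseteq> C" by (auto simp: fan_eq' C_def)
  have bC: "bounded C" by (rule bounded_subset[OF bounded_cball[of 0 b]]) (auto simp: C_def)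
  define m where "m = (a + b) / 2"
  have m: "a < m" "m < b" "0 < m" using ab by (simp_all add: m_def)
  have "complex_of_real m \<in> C - fan S a b"
  proof -
    have "aarg (of_real m) = 0" using m aarg_polar_abs[of m 0] by simp
    moreover have "norm (complex_of_real m) = m" using m by simp
    ultimately show ?thesis using m mid[OF m(1,2)] by (simp add: C_def fan_eq')
  qed
  then have ne: "C - fan S a b \<noteq> {}" by blast
  show "inside (fan S a b) = C - fan S a b" "outside (fan S a b) = - C"
    using inside_Jordan_eq[OF Jordan sub oC bC oN ne] .
qed

text \<open>The arcs start on the negative real axis, so the curve surrounds
  \<open>ball 0 a\<close>. The continuation rises above \<open>pi\<close> inwards, which puts this
  disc inside, and drops below \<open>0\<close> outwards.\<close>

lemma fan_outer:
  assumes 0: "S a = pi" "S b = 0"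
  defines "C \<equiv> {z. norm z < a \<or> a \<le> norm z \<and> norm z \<le> b \<and> aarg z \<le> S (norm z)}"
  shows "inside (fan S a b) = C - fan S a b" "fan S a b \<subseteq> C" "outside (fan S a b) = - C"
proof -
  define E where "E = ext_S 1 (-1)"
  note E = ext_S[where A = "1" and B = "-1", folded E_def]
  let ?P = "{z. z \<noteq> 0 \<and> E (norm z) < aarg z}" and ?N = "{z. z \<noteq> 0 \<and> aarg z < E (norm z)}"
  note op = open_aarg_less[OF E(1)]
  have ne: "z \<noteq> 0" if "a \<le> norm z" for z :: complex using that ab by auto
  have "- C = ?P"
  proof -
    have "z \<in> - C \<longleftrightarrow> z \<in> ?P" for z
      using E(2,3,4)[of "norm z"] ne[of z] aarg_bounds[of z] 0 ab
      by (cases "z = 0"; cases "norm z < a"; cases "norm z > b") (auto simp: C_def not_less)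
    then show ?thesis by blast
  qed
  then have oC: "open (- C)" using op by auto
  have "C - fan S a b = ?N \<union> ball 0 a"
  proof -
    have "z \<in> C - fan S a b \<longleftrightarrow> z \<in> ?N \<union> ball 0 a" for z
      using E(2,3,4)[of "norm z"] ne[of z] aarg_bounds[of z] 0 ab
      by (cases "z = 0"; cases "norm z < a"; cases "norm z > b") (auto simp: C_def not_less fan_eq')
    then show ?thesis by blast
  qed
  then have oN: "open (C - fan S a b)" using op by auto
  show sub: "fan S a b \<subseteq> C" by (auto simp: fan_eq' C_def)
  have bC: "bounded C" by (rule bounded_subset[OF bounded_cball[of 0 b]]) (use ab in \<open>auto simp: C_def\<close>)
  have "0 \<in> C - fan S a b" using ab by (auto simp: C_def fan_eq')
  then have ne: "C - fan S a b \<noteq> {}" by blast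
  show "inside (fan S a b) = C - fan S a b" "outside (fan S a b) = - C"
    using inside_Jordan_eq[OF Jordan sub oC bC oN ne] .
qed

text \<open>The arcs now close up on the negative real axis at the larger radius, so the points of
  large angle are the inner ones and the strict inequality is reversed.\<close>

lemma fan_inner:
  assumes 0: "S a = 0" "S b = pi"
  defines "C \<equiv> {z. norm z < a \<or> a \<le> norm z \<and> norm z \<le> b \<and> S (norm z) \<le> aarg z}"
  shows "inside (fan S a b) = C - fan S a b" "fan S a b \<subseteq> C" "outside (fan S a b) = - C"
proof -
  define E where "E = ext_S (-1) 1"
  note E = ext_S[where A = "-1" and B = "1", folded E_def]
  let ?P = "{z. z \<noteq> 0 \<and> E (norm z) < aarg z}" and ?N = "{z. z \<noteq> 0 \<and> aarg z < E (norm z)}"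
  note op = open_aarg_less[OF E(1)]
  have ne: "z \<noteq> 0" if "a \<le> norm z" for z :: complex using that ab by auto
  have "- C = ?N"
  proof -
    have "z \<in> - C \<longleftrightarrow> z \<in> ?N" for z
      using E(2,3,4)[of "norm z"] ne[of z] aarg_bounds[of z] 0 ab
      by (cases "z = 0"; cases "norm z < a"; cases "norm z > b") (auto simp: C_def not_less)
    then show ?thesis by blast
  qed
  then have oC: "open (- C)" using op by auto
  have "C - fan S a b = ?P \<union> ball 0 a"
  proof -
    have "z \<in> C - fan S a b \<longleftrightarrow> z \<in> ?P \<union> ball 0 a" for z
      using E(2,3,4)[of "norm z"] ne[of z] aarg_bounds[of z] 0 ab
      by (cases "z = 0"; cases "norm z < a"; cases "norm z > b") (auto simp: C_def not_less fan_eq')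
    then show ?thesis by blast
  qed
  then have oN: "open (C - fan S a b)" using op by auto
  show sub: "fan S a b \<subseteq> C" by (auto simp: fan_eq' C_def)
  have bC: "bounded C" by (rule bounded_subset[OF bounded_cball[of 0 b]]) (use ab in \<open>auto simp: C_def\<close>)
  have "0 \<in> C - fan S a b" using ab by (auto simp: C_def fan_eq')
  then have ne: "C - fan S a b \<noteq> {}" by blast
  show "inside (fan S a b) = C - fan S a b" "outside (fan S a b) = - C"
    using inside_Jordan_eq[OF Jordan sub oC bC oN ne] .
qed

end

section \<open>Frontiers of Jordan regions and rings\<close>

lemma frontier_Jordan_region:
  assumes "closed_Jordan_curve J" shows "frontier (Jordan_region J) = J"
proof -
  note s = Jordan_curve_sides[OF assms]
  have "Jordan_region J = - outside J" unfolding Jordan_region_def using s(5,6) outside_no_overlap[of J] by blast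
  then show ?thesis using s(9) by (simp add: frontier_complement)
qed

text \<open>The ring is the complement of \<open>outside Jo \<union> inside Ji\<close>, two open
  sets whose frontiers are the two curves. By \<open>sub\<close> both curves belong to the ring;
  they may touch.\<close>

lemma frontier_Jordan_ring:
  assumes O: "closed_Jordan_curve Jo" and I: "closed_Jordan_curve Ji"
    and sub: "Jo \<union> Ji \<subseteq> Jordan_ring Jo Ji"
  shows "frontier (Jordan_ring Jo Ji) = Jo \<union> Ji"
proof -
  let ?V = "Jordan_ring Jo Ji"
  note o = Jordan_curve_sides[OF O] and i = Jordan_curve_sides[OF I]
  have reg: "Jordan_region Jo = - outside Jo"
    unfolding Jordan_region_def using o(5,6) outside_no_overlap[of Jo] by blast
  then have V: "?V = - (outside Jo \<union> inside Ji)" by (auto simp: Jordan_ring_def)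
  have cV: "closed ?V" unfolding V using o(2) i(1) by auto
  have "open (inside Jo \<inter> outside Ji)" using o(1) i(2) by blast
  moreover have "?V - (Jo \<union> Ji) = inside Jo \<inter> outside Ji"
    unfolding V using o(5,6) i(5,6) by blast
  ultimately have "?V - (Jo \<union> Ji) \<subseteq> interior ?V" by (intro interior_maximal) auto
  moreover have "Jo \<subseteq> closure (- ?V)"
  proof -
    have "Jo \<subseteq> closure (outside Jo)" using o(9) by (auto simp: frontier_def)
    then show ?thesis using closure_mono[of "outside Jo" "- ?V"] V by auto
  qed
  moreover have "Ji \<subseteq> closure (- ?V)"
  proof -
    have "Ji \<subseteq> closure (inside Ji)" using i(8) by (auto simp: frontier_def)
    then show ?thesis using closure_mono[of "inside Ji" "- ?V"] V by auto
  qed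
  ultimately show ?thesis
    using sub cV by (auto simp: frontier_def closure_complement)
qed

section \<open>The value region\<close>

locale value_region =
  fixes z0 T :: real
  assumes z0: "0 < z0" "z0 < 1" and T: "0 < T"
begin

text \<open>The radius equation says that \<open>T\<close> is the mean of \<open>A r\<close> and \<open>B r\<close> with weight \<open>lam x\<close> on \<open>A r\<close>.
  Eliminating \<open>x\<close> turns \<open>angle\<close> into \<open>S r\<close>, the geometric mean of \<open>T - B r\<close> and \<open>A r - T\<close>.\<close>

definition A :: "real \<Rightarrow> real" where "A r = 2 * ln (1 - r) - 2 * ln (1 - z0) - ln r + ln z0"

definition B :: "real \<Rightarrow> real" where "B r = 2 * ln (1 + r) - 2 * ln (1 + z0) - ln r + ln z0"

definition S :: "real \<Rightarrow> real" where "S r = sqrt ((T - B r) * (A r - T))"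

definition lam :: "real \<Rightarrow> real" where "lam x = (1 + x) * (1 - z0)\<^sup>2 / (2 * (1 - 2 * x * z0 + z0\<^sup>2))"

lemma den_pos: "x \<le> 1 \<Longrightarrow> 0 < 1 - 2 * x * z0 + z0\<^sup>2"
proof -
  assume "x \<le> 1"
  then have "x * z0 \<le> 1 * z0" using z0 by (intro mult_right_mono) auto
  then have "(1 - z0)\<^sup>2 \<le> 1 - 2 * x * z0 + z0\<^sup>2" by (simp add: power2_eq_square algebra_simps)
  moreover have "0 < (1 - z0)\<^sup>2" using z0 by (intro zero_less_power) simp
  ultimately show ?thesis by linarith
qed

lemma lam_less:
  assumes "x < y" "y \<le> 1" shows "lam x < lam y"
proof -
  note d = den_pos[of x] den_pos[of y]
  have "(1 + y) * (1 - 2 * x * z0 + z0\<^sup>2) - (1 + x) * (1 - 2 * y * z0 + z0\<^sup>2) = (y - x) * (1 + z0)\<^sup>2"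
    by (simp add: power2_eq_square algebra_simps)
  moreover have "0 < (y - x) * (1 + z0)\<^sup>2" using assms z0 by simp
  ultimately have "(1 + x) * (1 - 2 * y * z0 + z0\<^sup>2) < (1 + y) * (1 - 2 * x * z0 + z0\<^sup>2)" by linarith
  then have "(1 + x) / (1 - 2 * x * z0 + z0\<^sup>2) < (1 + y) / (1 - 2 * y * z0 + z0\<^sup>2)"
    using d assms by (simp add: divide_less_eq less_divide_eq)
  then have "(1 - z0)\<^sup>2 / 2 * ((1 + x) / (1 - 2 * x * z0 + z0\<^sup>2)) < (1 - z0)\<^sup>2 / 2 * ((1 + y) / (1 - 2 * y * z0 + z0\<^sup>2))"
    using z0 by (intro mult_strict_left_mono) auto
  then show ?thesis by (simp add: lam_def mult.commute)
qed

lemma lam_ends: "lam (-1) = 0" "lam 1 = 1"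
proof -
  have "1 - 2 * z0 + z0\<^sup>2 = (1 - z0)\<^sup>2" by (simp add: power2_eq_square algebra_simps)
  then show "lam (-1) = 0" "lam 1 = 1" using z0 by (simp_all add: lam_def)
qed

lemma lam_range: "-1 \<le> x \<Longrightarrow> x \<le> 1 \<Longrightarrow> 0 \<le> lam x \<and> lam x \<le> 1"
  using lam_less[of "-1" x] lam_less[of x 1] lam_ends by (cases "x = -1"; cases "x = 1") auto

lemma lam_surj:
  assumes "0 \<le> l" "l \<le> 1" obtains x where "-1 \<le> x" "x \<le> 1" "lam x = l"
proof -
  have "continuous_on {-1..1} lam"
    unfolding lam_def using den_pos by (intro continuous_intros) fastforce
  then show ?thesis using IVT'[of lam "-1" l 1] lam_ends assms that by auto
qed

section \<open>The extremal disc in terms of \<open>A\<close> and \<open>B\<close>\<close>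

lemma artanh_ln:
  fixes r :: real assumes "0 \<le> r" "r < 1" shows "2 * artanh r = ln (1 + r) - ln (1 - r)"
  using assms ln_div[of "1 + r" "1 - r"] by (simp add: artanh_def)

lemma cpot_ln:
  assumes "0 \<le> r" "r < 1" shows "cpot r = - ln (1 - r) - ln (1 + r)"
proof -
  have "1 - r\<^sup>2 = (1 - r) * (1 + r)" by (simp add: power2_eq_square algebra_simps)
  then show ?thesis using assms by (simp add: cpot_def ln_mult)
qed

text \<open>With \<open>L = T + ln r - ln z0\<close> and with centre \<open>H\<close> and radius
  \<open>R\<close> of the extremal disc, the factors are \<open>R - (L - H)\<close> and
  \<open>R + (L - H)\<close>. Thus \<open>S r\<close> is half the chord cut out of the disc by the
  vertical line of abscissa \<open>L\<close>.\<close>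

lemma A_pot:
  assumes "0 < r" "r < 1"
  shows "A r - T = (cpot z0 - cpot r) + (rpot z0 - rpot r) - (T + ln r - ln z0)"
    "T - B r = (T + ln r - ln z0) - (cpot z0 - cpot r) + (rpot z0 - rpot r)"
    "A r - B r = 4 * (artanh z0 - artanh r)"
  using artanh_ln[of r] artanh_ln[of z0] cpot_ln[of r] cpot_ln[of z0] assms z0
  by (simp_all add: A_def B_def rpot_def)

lemma A_deriv: "0 < r \<Longrightarrow> r < 1 \<Longrightarrow> (A has_real_derivative - 2 / (1 - r) - 1 / r) (at r)"
  unfolding A_def[abs_def] by (auto intro!: derivative_eq_intros)

lemma B_deriv: "0 < r \<Longrightarrow> r < 1 \<Longrightarrow> (B has_real_derivative 2 / (1 + r) - 1 / r) (at r)"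
  unfolding B_def[abs_def] by (auto intro!: derivative_eq_intros)

lemma A_less: assumes "0 < r" "r < s" "s < 1" shows "A s < A r"
proof (rule DERIV_neg_imp_decreasing[OF assms(2)])
  fix x assume x: "r \<le> x" "x \<le> s"
  have "- 2 / (1 - x) < 0" using x assms by (intro divide_neg_pos) auto
  moreover have "0 < 1 / x" using x assms by simp
  ultimately have "- 2 / (1 - x) - 1 / x < 0" by linarith
  then show "\<exists>y. (A has_real_derivative y) (at x) \<and> y < 0"
    using A_deriv[of x] x assms by (intro exI[of _ "- 2 / (1 - x) - 1 / x"] conjI) auto
qed

lemma B_less: assumes "0 < r" "r < s" "s < 1" shows "B s < B r"
proof (rule DERIV_neg_imp_decreasing[OF assms(2)])
  fix x assume x: "r \<le> x" "x \<le> s"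
  have "2 / (1 + x) - 1 / x = (x - 1) / (x * (1 + x))" using x assms by (simp add: field_simps)
  also have "\<dots> < 0" using x assms by (intro divide_neg_pos) auto
  finally have "2 / (1 + x) - 1 / x < 0" .
  then show "\<exists>y. (B has_real_derivative y) (at x) \<and> y < 0"
    using B_deriv[of x] x assms by (intro exI[of _ "2 / (1 + x) - 1 / x"]) auto
qed

lemma AB_z0: "A z0 = 0" "B z0 = 0" by (simp_all add: A_def B_def)

lemma rpot_less: assumes "0 \<le> r" "r < s" "s < 1" shows "rpot r < rpot s"
proof (rule DERIV_pos_imp_increasing[OF assms(2)])
  fix x assume x: "r \<le> x" "x \<le> s"
  then have "x\<^sup>2 < 1" using assms by (simp add: abs_square_less_1)
  then show "\<exists>y. (rpot has_real_derivative y) (at x) \<and> 0 < y"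
    using rpot_deriv[of x] x assms by (intro exI[of _ "2 / (1 - x\<^sup>2)"]) auto
qed

lemma B_less_A: assumes "0 < r" "r < z0" shows "0 < B r" "B r < A r"
proof -
  show "0 < B r" using B_less[OF assms z0(2)] AB_z0 by simp
  have "artanh r < artanh z0" using rpot_less[of r z0] assms z0 by (simp add: rpot_def)
  then show "B r < A r" using A_pot(3)[of r] assms z0 by simp
qed

text \<open>The coefficients of the first two logarithms add up to \<open>2 * D\<close>, so they are
  \<open>2 * D\<close> times complementary weights; division by \<open>D\<close> leaves the mean of
  \<open>A r\<close> and \<open>B r\<close>.\<close>

lemma radius_equation_iff:
  assumes x: "-1 \<le> x" "x \<le> 1" and r: "0 < r" "r < 1"
  shows "radius_equation z0 T x r \<longleftrightarrow> lam x * A r + (1 - lam x) * B r = T"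
proof -
  define D where "D = 1 - 2 * x * z0 + z0\<^sup>2"
  have D: "D > 0" using den_pos x by (simp add: D_def)
  have l: "(1 + x) * (1 - z0)\<^sup>2 = 2 * D * lam x"
    using D by (simp add: lam_def D_def[symmetric])
  have "(1 + x) * (1 - z0)\<^sup>2 + (1 - x) * (1 + z0)\<^sup>2 = 2 * D"
    by (simp add: D_def power2_eq_square algebra_simps)
  then have m: "(1 - x) * (1 + z0)\<^sup>2 = 2 * D * (1 - lam x)" using l by (simp add: algebra_simps)
  have ln: "ln (exp (- T) * z0) = ln z0 - T" using z0 by (simp add: ln_mult)
  have "radius_equation z0 T x r \<longleftrightarrow> D * (lam x * A r + (1 - lam x) * B r) = D * T"
    unfolding radius_equation_def l m ln D_def[symmetric] A_def B_def by (simp add: algebra_simps)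
  then show ?thesis using D by simp
qed

section \<open>The radius as a function of x\<close>

lemma mix_less:
  assumes x: "-1 \<le> x" "x \<le> 1" and r: "0 < r" "r < s" "s < 1"
  shows "lam x * A s + (1 - lam x) * B s < lam x * A r + (1 - lam x) * B r"
proof (cases "lam x = 0")
  case True then show ?thesis using B_less[OF r] by simp
next
  case False
  then have "lam x * A s < lam x * A r" using lam_range[OF x] A_less[OF r] by (intro mult_strict_left_mono) auto
  moreover have "(1 - lam x) * B s \<le> (1 - lam x) * B r"
    using lam_range[OF x] B_less[OF r] by (intro mult_left_mono) auto
  ultimately show ?thesis by linarith
qed

lemma radius_ex:
  assumes x: "-1 \<le> x" "x \<le> 1"
  obtains r where "0 < r" "r < z0" "lam x * A r + (1 - lam x) * B r = T"
proof -
  let ?h = "\<lambda>r. lam x * A r + (1 - lam x) * B r"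
  \<comment> \<open>Chosen so that \<open>B r1 = T + 2 * ln (1 + r1)\<close>, which exceeds
    \<open>T\<close>; at \<open>z0\<close> the mean is \<open>0 < T\<close>.\<close>
  define r1 where "r1 = z0 * exp (- T - 2 * ln (1 + z0))"
  have "- T - 2 * ln (1 + z0) < 0" using z0 T ln_gt_zero[of "1 + z0"] by linarith
  then have r1: "0 < r1" "r1 < z0" using z0 by (simp_all add: r1_def)
  have "ln r1 = ln z0 - T - 2 * ln (1 + z0)" using z0 by (simp add: r1_def ln_mult)
  then have "B r1 = 2 * ln (1 + r1) + T" by (simp add: B_def)
  then have B1: "T \<le> B r1" using r1 by simp
  have A1: "T \<le> A r1" using B1 B_less_A[OF r1] by simp
  have "lam x * T \<le> lam x * A r1" "(1 - lam x) * T \<le> (1 - lam x) * B r1"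
    using lam_range[OF x] A1 B1 by (auto intro: mult_left_mono)
  then have h1: "T \<le> ?h r1" by (simp add: algebra_simps)
  have "continuous_on {r1..z0} ?h"
    unfolding A_def B_def using r1 z0 by (intro continuous_intros) auto
  then obtain r where r: "r1 \<le> r" "r \<le> z0" "?h r = T"
    using IVT2'[of ?h z0 T r1] h1 r1 T AB_z0 by auto
  then have "r \<noteq> z0" using T AB_z0 by auto
  then show ?thesis using that[of r] r r1 by simp
qed

lemma radius_ex1:
  assumes x: "-1 \<le> x" "x \<le> 1"
  shows "\<exists>!r. r \<in> {0<..<1} \<and> radius_equation z0 T x r"
proof -
  obtain r where r: "0 < r" "r < z0" "lam x * A r + (1 - lam x) * B r = T"
    using radius_ex[OF x] .
  show ?thesis
  proof (rule ex1I[of _ r])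
    show "r \<in> {0<..<1} \<and> radius_equation z0 T x r"
      using r z0 radius_equation_iff[OF x] by auto
    fix s assume s: "s \<in> {0<..<1} \<and> radius_equation z0 T x s"
    then have "lam x * A s + (1 - lam x) * B s = T" using radius_equation_iff[OF x] by auto
    then show "s = r" using mix_less[OF x, of r s] mix_less[OF x, of s r] r s z0 by (cases r s rule: linorder_cases) auto
  qed
qed

abbreviation rad :: "real \<Rightarrow> real" where "rad x \<equiv> radius z0 T x"

lemma rad:
  assumes x: "-1 \<le> x" "x \<le> 1"
  shows "0 < rad x" "rad x < z0" "lam x * A (rad x) + (1 - lam x) * B (rad x) = T"
proof -
  obtain r where r: "0 < r" "r < z0" "lam x * A r + (1 - lam x) * B r = T"
    using radius_ex[OF x] .
  have "rad x = r"
    unfolding radius_def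
    by (rule the1_equality[OF radius_ex1[OF x]]) (use r z0 radius_equation_iff[OF x] in auto)
  then show "0 < rad x" "rad x < z0" "lam x * A (rad x) + (1 - lam x) * B (rad x) = T" using r by auto
qed

lemma rad_eqI:
  assumes x: "-1 \<le> x" "x \<le> 1" and r: "0 < r" "r < 1" "lam x * A r + (1 - lam x) * B r = T"
  shows "rad x = r"
  unfolding radius_def
  by (rule the1_equality[OF radius_ex1[OF x]]) (use r radius_equation_iff[OF x] in auto)

text \<open>Below \<open>z0\<close> one has \<open>A > B\<close>, so a larger \<open>x\<close>
  shifts weight to the larger term. As the mean decreases in \<open>r\<close>, the radius must grow
  to restore the value \<open>T\<close>.\<close>

lemma rad_less:
  assumes x: "-1 \<le> x" "x < y" "y \<le> 1" shows "rad x < rad y"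
proof (rule ccontr)
  assume "\<not> rad x < rad y"
  then have le: "rad y \<le> rad x" by simp
  have x1: "x \<le> 1" and y1: "-1 \<le> y" using x by auto
  note rx = rad[OF x(1) x1] and ry = rad[OF y1 x(3)]
  have "lam y * A (rad x) + (1 - lam y) * B (rad x) \<le> T"
    using mix_less[OF y1 x(3) ry(1), of "rad x"] le rx ry z0 by (cases "rad y = rad x") auto
  moreover have "(lam y - lam x) * (A (rad x) - B (rad x)) > 0"
    using lam_less[OF x(2,3)] B_less_A[OF rx(1,2)] by simp
  ultimately show False using rx(3) by (simp add: algebra_simps)
qed

abbreviation "ra \<equiv> rad (-1)"
abbreviation "rb \<equiv> rad 1"

lemma rad_ends: "0 < ra" "ra < rb" "rb < z0" "B ra = T" "A rb = T"
  using rad[of "-1"] rad[of 1] rad_less[of "-1" 1] lam_ends by auto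

lemma AB_between:
  assumes "ra \<le> r" "r \<le> rb"
  shows "0 \<le> T - B r" "0 \<le> A r - T" "r < 1" "0 < r" "r < z0"
  using assms rad_ends B_less[of ra r] A_less[of r rb] z0
  by (cases "r = ra"; cases "r = rb"; force)+

lemma AB_between_strict:
  assumes "ra < r" "r < rb" shows "0 < T - B r" "0 < A r - T"
  using assms rad_ends B_less[of ra r] A_less[of r rb] z0 by auto

lemma rad_surj:
  assumes "ra \<le> r" "r \<le> rb" obtains x where "-1 \<le> x" "x \<le> 1" "rad x = r"
proof -
  note r = AB_between[OF assms]
  have AB: "B r < A r" using B_less_A r by simp
  define l where "l = (T - B r) / (A r - B r)"
  have "0 \<le> l" "l \<le> 1" using r AB by (simp_all add: l_def divide_le_eq)
  then obtain x where x: "-1 \<le> x" "x \<le> 1" "lam x = l" using lam_surj by blast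
  have "l * (A r - B r) = T - B r" using AB by (simp add: l_def)
  then have "rad x = r" using x r by (intro rad_eqI) (auto simp: algebra_simps)
  then show ?thesis using that x by blast
qed

lemma rad_le_iff:
  assumes "-1 \<le> x" "x \<le> 1" "-1 \<le> y" "y \<le> 1" shows "rad x \<le> rad y \<longleftrightarrow> x \<le> y"
  using rad_less[of x y] rad_less[of y x] assms by (cases x y rule: linorder_cases) auto

lemma rad_image:
  assumes "-1 \<le> x" "x \<le> y" "y \<le> 1" shows "radius z0 T ` {x..y} = {rad x..rad y}"
proof
  show "radius z0 T ` {x..y} \<subseteq> {rad x..rad y}" using assms rad_le_iff by auto
  show "{rad x..rad y} \<subseteq> radius z0 T ` {x..y}"
  proof
    fix r assume r: "r \<in> {rad x..rad y}"
    have "ra \<le> rad x" "rad y \<le> rb" using assms rad_le_iff[of "-1" x] rad_le_iff[of y 1] by auto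
    then obtain u where u: "-1 \<le> u" "u \<le> 1" "rad u = r" using rad_surj[of r] r by auto
    then have "u \<in> {x..y}" using r assms rad_le_iff[of x u] rad_le_iff[of u y] by auto
    then show "r \<in> radius z0 T ` {x..y}" using u by blast
  qed
qed

text \<open>The factors under the root of \<open>S\<close> are \<open>lam x * d\<close> and
  \<open>(1 - lam x) * d\<close> with \<open>d = 4 * (artanh z0 - artanh (rad x))\<close>, and
  \<open>lam x * (1 - lam x)\<close> equals
  \<open>(1 - z0^2)^2 * (1 - x^2) / (4 * D^2)\<close>.\<close>

lemma angle_eq:
  assumes x: "-1 \<le> x" "x \<le> 1" shows "angle z0 T x = S (rad x)"
proof -
  define D where "D = 1 - 2 * x * z0 + z0\<^sup>2"
  have D: "D > 0" using den_pos x by (simp add: D_def)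
  note r = rad[OF x]
  define d where "d = A (rad x) - B (rad x)"
  have d: "d > 0" using B_less_A[OF r(1,2)] by (simp add: d_def)
  have u: "T - B (rad x) = lam x * d" and v: "A (rad x) - T = (1 - lam x) * d"
    using r(3) by (simp_all add: d_def algebra_simps)
  have l: "lam x = (1 + x) * (1 - z0)\<^sup>2 / (2 * D)" by (simp add: lam_def D_def)
  have "(1 + x) * (1 - z0)\<^sup>2 + (1 - x) * (1 + z0)\<^sup>2 = 2 * D"
    by (simp add: D_def power2_eq_square algebra_simps)
  then have m: "1 - lam x = (1 - x) * (1 + z0)\<^sup>2 / (2 * D)" using D by (simp add: l field_simps)
  have "(T - B (rad x)) * (A (rad x) - T) = (d * (1 - z0\<^sup>2) / (2 * D))\<^sup>2 * (1 - x\<^sup>2)"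
    unfolding u v l m[unfolded l] using D by (simp add: power2_eq_square field_simps)
  then have "S (rad x) = d * (1 - z0\<^sup>2) / (2 * D) * sqrt (1 - x\<^sup>2)"
    using d D z0 by (simp add: S_def real_sqrt_mult abs_square_le_1)
  also have "d = 4 * (artanh z0 - artanh (rad x))"
    using A_pot(3)[of "rad x"] r z0 by (simp add: d_def)
  finally show ?thesis unfolding angle_def D_def[symmetric] using D by (simp add: field_simps)
qed

lemma w_image:
  assumes "-1 \<le> x" "x \<le> y" "y \<le> 1"
  shows "w_plus z0 T ` {x..y} = (\<lambda>r. of_real r * exp (\<i> * of_real (S r))) ` {rad x..rad y}"
    "w_minus z0 T ` {x..y} = (\<lambda>r. of_real r * exp (- \<i> * of_real (S r))) ` {rad x..rad y}"
proof -
  have "w_plus z0 T u = of_real (rad u) * exp (\<i> * of_real (S (rad u)))"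
    "w_minus z0 T u = of_real (rad u) * exp (- \<i> * of_real (S (rad u)))" if "u \<in> {x..y}" for u
    using that assms by (simp_all add: w_plus_def w_minus_def angle_eq)
  then show "w_plus z0 T ` {x..y} = (\<lambda>r. of_real r * exp (\<i> * of_real (S r))) ` {rad x..rad y}"
    "w_minus z0 T ` {x..y} = (\<lambda>r. of_real r * exp (- \<i> * of_real (S r))) ` {rad x..rad y}"
    unfolding rad_image[OF assms, symmetric] image_image by (auto intro!: image_cong)
qed

lemma w_fan:
  assumes "-1 \<le> x" "x \<le> y" "y \<le> 1"
  shows "w_plus z0 T ` {x..y} \<union> w_minus z0 T ` {x..y} = fan S (rad x) (rad y)"
  unfolding fan_def w_image[OF assms] ..

lemma S_cont: "continuous_on {ra..rb} S"
  unfolding S_def[abs_def] A_def B_def using AB_between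
  by (intro continuous_intros) force+

lemma S_ends: "S ra = 0" "S rb = 0"
  using rad_ends by (simp_all add: S_def)

lemma S_pos: "ra < r \<Longrightarrow> r < rb \<Longrightarrow> 0 < S r"
  using AB_between_strict[of r] by (simp add: S_def)

text \<open>The geometric mean is at most the arithmetic mean, here
  \<open>2 * (artanh z0 - artanh r)\<close>. This is the origin of the threshold
  \<open>artanh z0 < pi / 2\<close>.\<close>

lemma S_less_artanh:
  assumes "ra \<le> r" "r \<le> rb" shows "S r < 2 * artanh z0"
proof -
  note r = AB_between[OF assms]
  have "S r \<le> ((T - B r) + (A r - T)) / 2"
    unfolding S_def using arith_geo_mean_sqrt[OF r(1,2)] .
  also have "\<dots> = 2 * (artanh z0 - artanh r)" using A_pot(3)[of r] r by simp
  also have "\<dots> < 2 * artanh z0" using rpot_less[of 0 r] r by (simp add: rpot_def)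
  finally show ?thesis .
qed

lemma value_range_subset:
  assumes "z \<in> value_range T (of_real z0)"
  shows "ra \<le> norm z \<and> norm z \<le> rb \<and> aarg z \<le> S (norm z)"
proof -
  obtain f where f: "f \<in> univalent_class T" "z = f (of_real z0)" using assms by (auto simp: value_range_def)
  obtain l where l: "l \<in> log_class T" "\<And>z. norm z < 1 \<Longrightarrow> f z = z * exp (l z)"
    using univalent_class_imp_log[OF f(1)] by metis
  have n: "norm (complex_of_real z0) < 1" using z0 by simp
  have z: "z = of_real z0 * exp (l (of_real z0))" using f l n by blast
  define k where "k = l (of_real z0)"
  define r where "r = norm z"
  have rk: "r = z0 * exp (Re k)" using z0 by (simp add: r_def z k_def norm_mult)
  then have r0: "r > 0" using z0 by simp
  have rz: "r \<le> z0" using norm_times_exp_le[OF l(1) n] z0 by (simp add: r_def z)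
  have r1: "r < 1" using rz z0 by simp
  have lnr: "ln r = ln z0 + Re k" using z0 by (simp add: rk ln_mult)
  have nw: "norm (of_real z0 * exp (l (of_real z0))) = r" by (simp only: r_def z)
  have "excess T l (of_real z0) \<le> 0" using excess_nonpos[OF l(1) _ n] T by simp
  then have "norm (of_real T + k - of_real (cpot z0 - cpot r)) \<le> rpot z0 - rpot r"
    using z0 unfolding excess_def nw k_def by simp
  then have "(norm (of_real T + k - of_real (cpot z0 - cpot r)))\<^sup>2 \<le> (rpot z0 - rpot r)\<^sup>2"
    by (intro power_mono) auto
  then have "(T + Re k - (cpot z0 - cpot r))\<^sup>2 + (Im k)\<^sup>2 \<le> (rpot z0 - rpot r)\<^sup>2"
    by (simp add: cmod_power2)
  moreover have "(T - B r) * (A r - T) = (rpot z0 - rpot r)\<^sup>2 - (T + Re k - (cpot z0 - cpot r))\<^sup>2"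
    unfolding A_pot(1,2)[OF r0 r1] lnr by (simp add: power2_eq_square algebra_simps)
  ultimately have g: "(Im k)\<^sup>2 \<le> (T - B r) * (A r - T)" by linarith
  then have g0: "0 \<le> (T - B r) * (A r - T)" using zero_le_power2[of "Im k"] by linarith
  \<comment> \<open>The product being nonnegative, the alternative is
    \<open>A r \<le> T \<le> B r\<close>. It contradicts \<open>B r < A r\<close> below
    \<open>z0\<close>, and \<open>T > 0\<close> at \<open>z0\<close>, where both functions
    vanish.\<close>
  have "B r \<le> T \<and> T \<le> A r"
  proof (rule ccontr)
    assume "\<not> (B r \<le> T \<and> T \<le> A r)"
    then have *: "T \<le> B r" "A r \<le> T" using g0 by (auto simp: zero_le_mult_iff)
    show False
    proof (cases "r = z0")
      case True then show False using * AB_z0 T by simp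
    next
      case False then show False using * B_less_A[OF r0] rz by simp
    qed
  qed
  then have "ra \<le> r" "r \<le> rb"
    using B_less[of r ra] A_less[of rb r] rad_ends r0 r1 z0 by force+
  moreover have "aarg z \<le> S r"
  proof -
    have "z = of_real r * exp (\<i> * of_real (Im k))"
      unfolding z k_def[symmetric] rk by (subst exp_eq_polar) (simp add: cis_conv_exp exp_of_real)
    then have "aarg z \<le> \<bar>Im k\<bar>" using aarg_polar_le[OF r0] by simp
    also have "\<dots> \<le> S r" unfolding S_def using g by (simp add: real_le_rsqrt)
    finally show ?thesis .
  qed
  ultimately show ?thesis by (simp add: r_def)
qed

lemma value_range_supset:
  assumes z: "ra \<le> norm z" "norm z \<le> rb" "aarg z \<le> S (norm z)"
  shows "z \<in> value_range T (of_real z0)"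
proof -
  define r where "r = norm z"
  note r = AB_between[OF z(1,2), folded r_def]
  have zne: "z \<noteq> 0" using r by (auto simp: r_def)
  obtain \<theta> where \<theta>: "z = of_real r * exp (\<i> * of_real \<theta>)" "\<bar>\<theta>\<bar> = aarg z"
  proof -
    from polar_aarg[OF zne] show ?thesis
    proof
      assume "z = of_real (norm z) * exp (\<i> * of_real (aarg z))"
      then show ?thesis using that[of "aarg z"] aarg_bounds[OF zne] by (simp add: r_def)
    next
      assume "z = of_real (norm z) * exp (- \<i> * of_real (aarg z))"
      then show ?thesis using that[of "- aarg z"] aarg_bounds[OF zne] by (simp add: r_def)
    qed
  qed
  define L where "L = T + ln r - ln z0"
  define H where "H = cpot z0 - cpot r"
  define R where "R = rpot z0 - rpot r"
  have R: "R > 0" using rpot_less[of r z0] r z0 by (simp add: R_def)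
  have "\<bar>\<theta>\<bar> \<le> S r" using \<theta>(2) z(3) by (simp add: r_def)
  then have "\<theta>\<^sup>2 \<le> (S r)\<^sup>2" using abs_le_square_iff[of \<theta> "S r"] by simp
  also have "(S r)\<^sup>2 = (T - B r) * (A r - T)" unfolding S_def using r by simp
  also have "\<dots> = R\<^sup>2 - (L - H)\<^sup>2"
    unfolding A_pot(1,2)[OF r(4,3)] R_def L_def H_def by (simp add: power2_eq_square algebra_simps)
  finally have \<theta>2: "(H - L)\<^sup>2 + \<theta>\<^sup>2 \<le> R\<^sup>2" by (simp add: power2_commute)
  \<comment> \<open>The relative position of the target in its disc: \<open>H - c * R\<close> is L +
    i \<theta>.\<close>
  define c where "c = Complex ((H - L) / R) (- \<theta> / R)"
  have "norm c \<le> 1"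
  proof -
    have "((H - L) / R)\<^sup>2 + (- \<theta> / R)\<^sup>2 = ((H - L)\<^sup>2 + \<theta>\<^sup>2) / R\<^sup>2"
      by (simp add: power_divide add_divide_distrib)
    also have "\<dots> \<le> 1" using \<theta>2 R by (simp add: divide_le_eq)
    finally show ?thesis by (simp add: c_def cmod_def)
  qed
  moreover have "norm (complex_of_real z0) < 1" "complex_of_real z0 \<noteq> 0" using z0 by auto
  ultimately obtain l where l: "l \<in> log_class T" and
    eq: "of_real T + l (of_real z0) = of_real (cpot (norm (complex_of_real z0)) - cpot (norm (of_real z0 * exp (l (of_real z0)))))
       - c * of_real (rpot (norm (complex_of_real z0)) - rpot (norm (of_real z0 * exp (l (of_real z0)))))"
    using steering_exact[of c "of_real z0" T] T by (metis less_imp_le)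
  define k where "k = l (of_real z0)"
  define s where "s = z0 * exp (Re k)"
  have ns: "norm (of_real z0 * exp (l (of_real z0))) = s" using z0 by (simp add: norm_mult k_def s_def)
  have eq': "of_real T + k = of_real (cpot z0 - cpot s) - c * of_real (rpot z0 - rpot s)"
    using eq z0 unfolding ns k_def by simp
  have s0: "s > 0" using z0 by (simp add: s_def)
  have s1: "s < 1" using norm_times_exp_le[OF l, of "of_real z0"] z0 unfolding ns by simp
  have lns: "ln s = ln z0 + Re k" using z0 by (simp add: s_def ln_mult)
  \<comment> \<open>Steering prescribes the position in the disc of the final modulus
    \<open>s\<close>, which is not yet known to be \<open>r\<close>. The real part of its equation
    says \<open>m s = m r\<close>, and \<open>m\<close> is strictly increasing.\<close>
  define m where "m x = ln x + cpot x - Re c * rpot x" for x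
  have mless: "m x < m y" if "0 < x" "x < y" "y < 1" for x y
  proof (rule DERIV_pos_imp_increasing[OF that(2)])
    fix u assume u: "x \<le> u" "u \<le> y"
    have u1: "0 < u" "u < 1" using u that by auto
    have q: "1 - u\<^sup>2 > 0" using u1 by (simp add: abs_square_less_1)
    have "Re c \<le> 1" using \<open>norm c \<le> 1\<close> complex_Re_le_cmod[of c] by linarith
    then have "u * Re c \<le> u * 1" using u1 by (intro mult_left_mono) auto
    then have "(1 - u)\<^sup>2 \<le> 1 + u\<^sup>2 - 2 * u * Re c" by (simp add: power2_eq_square algebra_simps)
    moreover have "0 < (1 - u)\<^sup>2" using u1 by (intro zero_less_power) simp
    ultimately have n: "0 < 1 + u\<^sup>2 - 2 * u * Re c" by linarith
    have "1 / u + 2 * u / (1 - u\<^sup>2) - Re c * (2 / (1 - u\<^sup>2)) = (1 + u\<^sup>2 - 2 * u * Re c) / (u * (1 - u\<^sup>2))"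
      using u1 q by (simp add: divide_simps power2_eq_square)
    then have pos: "0 < 1 / u + 2 * u / (1 - u\<^sup>2) - Re c * (2 / (1 - u\<^sup>2))"
      using n u1 q by simp
    have "(m has_real_derivative (1 / u + 2 * u / (1 - u\<^sup>2) - Re c * (2 / (1 - u\<^sup>2)))) (at u)"
      unfolding m_def using u1 q
      by (auto intro!: derivative_eq_intros cpot_deriv rpot_deriv)
    then show "\<exists>y. (m has_real_derivative y) (at u) \<and> 0 < y" using pos by blast
  qed
  have Rec: "Re c * R = H - L" "Im c * R = - \<theta>" using R by (simp_all add: c_def)
  have "T + Re k = (cpot z0 - cpot s) - Re c * (rpot z0 - rpot s)" using arg_cong[OF eq', of Re] by simp
  then have "m s = ln z0 - T + cpot z0 - Re c * rpot z0" using lns by (simp add: m_def algebra_simps)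
  also have "\<dots> = m r" using Rec(1) by (simp add: m_def R_def H_def L_def algebra_simps)
  finally have sr: "s = r" using mless[of s r] mless[of r s] s0 s1 r by (cases s r rule: linorder_cases) auto
  have "Im k = - (Im c * (rpot z0 - rpot s))" using arg_cong[OF eq', of Im] by simp
  then have "Im k = \<theta>" using Rec(2) by (simp add: sr R_def)
  then have "of_real z0 * exp k = z"
    unfolding \<theta>(1) sr[symmetric] s_def by (subst exp_eq_polar) (simp add: cis_conv_exp exp_of_real)
  then show ?thesis
    unfolding value_range_def mem_Collect_eq using log_imp_univalent_class[OF l T]
    by (intro exI[of _ "\<lambda>z. z * exp (l z)"]) (simp add: k_def)
qed

lemma value_range_eq:
  "value_range T (of_real z0) = {z. ra \<le> norm z \<and> norm z \<le> rb \<and> aarg z \<le> S (norm z)}"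
  using value_range_subset value_range_supset by blast

section \<open>The boundary curves in the three cases\<close>

lemma fan_curve_simple:
  assumes "\<And>r. ra \<le> r \<Longrightarrow> r \<le> rb \<Longrightarrow> S r \<noteq> pi"
  shows "fan_curve S ra rb"
proof
  show "0 < ra" "ra < rb" "continuous_on {ra..rb} S" "S ra \<in> {0, pi}" "S rb \<in> {0, pi}"
    using rad_ends S_cont S_ends by auto
  fix r assume r: "ra < r" "r < rb"
  have "S r < pi"
  proof (rule ccontr)
    assume "\<not> S r < pi"
    then obtain s where "ra \<le> s" "s \<le> r" "S s = pi"
      using IVT'[of S ra pi r] S_ends r continuous_on_subset[OF S_cont, of "{ra..r}"] by auto
    then show False using assms[of s] r by simp
  qed
  then show "0 < S r \<and> S r < pi" using S_pos r by simp
qed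

lemma simple_case:
  assumes "\<And>r. ra \<le> r \<Longrightarrow> r \<le> rb \<Longrightarrow> S r \<noteq> pi"
  shows "closed_Jordan_curve (C_plus z0 T \<union> C_minus z0 T) \<and>
            value_range T (complex_of_real z0) = Jordan_region (C_plus z0 T \<union> C_minus z0 T) \<and>
            frontier (value_range T (complex_of_real z0)) = C_plus z0 T \<union> C_minus z0 T \<and>
            C_plus z0 T \<inter> C_minus z0 T = {w_plus z0 T (-1), w_plus z0 T 1} \<and>
            w_plus z0 T (-1) = w_minus z0 T (-1) \<and> w_plus z0 T 1 = w_minus z0 T 1"
proof -
  interpret fan_curve S ra rb using fan_curve_simple[OF assms] .
  have C: "C_plus z0 T \<union> C_minus z0 T = fan S ra rb"
    unfolding C_plus_def C_minus_def by (rule w_fan) auto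
  have V: "value_range T (of_real z0) = Jordan_region (fan S ra rb)"
    unfolding Jordan_region_def value_range_eq using fan_simple[OF S_ends] by blast
  have w: "w_plus z0 T (-1) = of_real ra * exp (\<i> * of_real (S ra))"
    "w_plus z0 T 1 = of_real rb * exp (\<i> * of_real (S rb))"
    "w_minus z0 T (-1) = of_real ra * exp (- \<i> * of_real (S ra))"
    "w_minus z0 T 1 = of_real rb * exp (- \<i> * of_real (S rb))"
    by (simp_all add: w_plus_def w_minus_def angle_eq)
  have "C_plus z0 T \<inter> C_minus z0 T = {w_plus z0 T (-1), w_plus z0 T 1}"
    unfolding w C_plus_def C_minus_def
    by (subst w_image, simp, simp, simp)+ (rule fan_Int)
  then show ?thesis
    unfolding C V using Jordan frontier_Jordan_region[OF Jordan] w fan_ends by simp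
qed

text \<open>As functions of \<open>log r\<close>, both \<open>T - B r\<close> and \<open>A r - T\<close> are concave, hence so is their geometric
  mean \<open>S\<close>. This is why at most one hole appears in the region.\<close>

lemma S_quasiconcave:
  assumes r: "ra \<le> r1" "r1 \<le> r" "r \<le> r2" "r2 \<le> rb" and S: "pi \<le> S r1" "pi \<le> S r2"
  shows "pi \<le> S r"
proof (cases "r1 = r2")
  case True then show ?thesis using r S by auto
next
  case False
  have r12: "0 < r1" "r1 < 1" "0 < r2" "r2 < 1" "0 < r" "r < 1"
    using r AB_between[of r1] AB_between[of r2] AB_between[of r] by auto
  have e1: "exp x < 1" if "x \<in> {..<0}" for x :: real using that by simp
  have cA: "convex_on {..<0} (\<lambda>x. - A (exp x))"
  proof (rule f''_ge0_imp_convex)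
    show "((\<lambda>x. - A (exp x)) has_real_derivative 2 * exp x / (1 - exp x) + 1) (at x)"
      if "x \<in> {..<0}" for x
    proof -
      have "((\<lambda>x. - A (exp x)) has_real_derivative - ((- 2 / (1 - exp x) - 1 / exp x) * exp x)) (at x)"
        using e1[OF that] by (intro DERIV_minus DERIV_chain2[OF A_deriv DERIV_exp]) auto
      then show ?thesis by (simp add: left_diff_distrib add.commute)
    qed
    show "((\<lambda>x. 2 * exp x / (1 - exp x) + 1) has_real_derivative 2 * exp x / (1 - exp x)\<^sup>2) (at x)"
      if "x \<in> {..<0}" for x :: real
      using e1[OF that] by (auto intro!: derivative_eq_intros simp: field_simps power2_eq_square)
  qed auto
  have cB: "convex_on {..<0} (\<lambda>x. B (exp x))"
  proof (rule f''_ge0_imp_convex)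
    show "((\<lambda>x. B (exp x)) has_real_derivative 2 * exp x / (1 + exp x) - 1) (at x)"
      if "x \<in> {..<0}" for x
    proof -
      have "((\<lambda>x. B (exp x)) has_real_derivative (2 / (1 + exp x) - 1 / exp x) * exp x) (at x)"
        using e1[OF that] by (intro DERIV_chain2[OF B_deriv DERIV_exp]) auto
      then show ?thesis by (simp add: left_diff_distrib)
    qed
    show "((\<lambda>x. 2 * exp x / (1 + exp x) - 1) has_real_derivative 2 * exp x / (1 + exp x)\<^sup>2) (at x)" for x :: real
    proof -
      have "1 + exp x \<noteq> 0" using add_pos_pos[OF zero_less_one exp_gt_zero[of x]] by simp
      then show ?thesis by (auto intro!: derivative_eq_intros simp: field_simps power2_eq_square)
    qed
  qed auto
  define t where "t = (ln r - ln r1) / (ln r2 - ln r1)"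
  have ln12: "ln r1 < ln r2" "ln r1 \<le> ln r" "ln r \<le> ln r2" using r r12 False by auto
  have t: "0 \<le> t" "t \<le> 1" using ln12 by (simp_all add: t_def)
  have "t * (ln r2 - ln r1) = ln r - ln r1" using ln12 by (simp add: t_def)
  then have lnr: "(1 - t) * ln r1 + t * ln r2 = ln r" by (simp add: algebra_simps)
  have neg: "ln r1 \<in> {..<0}" "ln r2 \<in> {..<0}" using r12 by auto
  define u where "u x = T - B x" for x
  define v where "v x = A x - T" for x
  have "- A r \<le> (1 - t) * - A r1 + t * - A r2"
    using convex_onD[OF cA t neg] r12 by (simp add: lnr)
  then have vr: "(1 - t) * v r1 + t * v r2 \<le> v r" by (simp add: v_def algebra_simps)
  have "B r \<le> (1 - t) * B r1 + t * B r2"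
    using convex_onD[OF cB t neg] r12 by (simp add: lnr)
  then have ur: "(1 - t) * u r1 + t * u r2 \<le> u r" by (simp add: u_def algebra_simps)
  have nn: "0 \<le> u r1" "0 \<le> v r1" "0 \<le> u r2" "0 \<le> v r2"
    using AB_between[of r1] AB_between[of r2] r by (auto simp: u_def v_def)
  have uv1: "pi\<^sup>2 \<le> u r1 * v r1" and uv2: "pi\<^sup>2 \<le> u r2 * v r2"
    using S nn power_mono[OF S(1), of 2] power_mono[OF S(2), of 2] by (simp_all add: S_def u_def v_def)
  \<comment> \<open>The mixed terms in the product of the two convex combinations; the
    arithmetic-geometric inequality bounds them below by means of the pure terms.\<close>
  have cross: "2 * pi\<^sup>2 \<le> u r1 * v r2 + u r2 * v r1"
  proof -
    have "pi\<^sup>2 * pi\<^sup>2 \<le> (u r1 * v r1) * (u r2 * v r2)" using uv1 uv2 nn by (intro mult_mono) auto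
    then have "pi\<^sup>2 * pi\<^sup>2 \<le> (u r1 * v r2) * (u r2 * v r1)" by (simp add: mult_ac)
    then have "sqrt (pi\<^sup>2 * pi\<^sup>2) \<le> sqrt ((u r1 * v r2) * (u r2 * v r1))" by simp
    also have "\<dots> \<le> (u r1 * v r2 + u r2 * v r1) / 2" using nn by (intro arith_geo_mean_sqrt) auto
    finally have "sqrt (pi\<^sup>2 * pi\<^sup>2) \<le> (u r1 * v r2 + u r2 * v r1) / 2" .
    moreover have "sqrt (pi\<^sup>2 * pi\<^sup>2) = pi\<^sup>2" by (rule real_sqrt_unique) (simp_all add: power2_eq_square)
    ultimately show ?thesis by simp
  qed
  have "pi\<^sup>2 = (1 - t)\<^sup>2 * pi\<^sup>2 + t\<^sup>2 * pi\<^sup>2 + t * (1 - t) * (2 * pi\<^sup>2)"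
    by (simp add: power2_eq_square algebra_simps)
  also have "\<dots> \<le> (1 - t)\<^sup>2 * (u r1 * v r1) + t\<^sup>2 * (u r2 * v r2) + t * (1 - t) * (u r1 * v r2 + u r2 * v r1)"
    using uv1 uv2 cross t by (intro add_mono mult_left_mono) auto
  also have "\<dots> = ((1 - t) * u r1 + t * u r2) * ((1 - t) * v r1 + t * v r2)"
    by (simp add: power2_eq_square algebra_simps)
  also have "\<dots> \<le> u r * v r"
    using ur vr nn t by (intro mult_mono) (auto intro!: add_nonneg_nonneg mult_nonneg_nonneg order_trans[OF _ ur])
  finally show ?thesis unfolding S_def u_def v_def by (simp add: real_le_rsqrt)
qed

text \<open>By quasiconcavity the radii with \<open>S r \<ge> pi\<close> fill one interval
  \<open>[p, q]\<close>, whose circles lie entirely in the value set. The arcs over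
  \<open>[q, rb]\<close> and \<open>[ra, p]\<close> form the outer and the inner curve; for
  \<open>p = q\<close> these touch at one point.\<close>

lemma ring_case:
  assumes x0: "x0 \<in> {-1..1}" "angle z0 T x0 = pi"
  shows "(\<exists>P. P \<subseteq> C_plus z0 T \<inter> C_minus z0 T \<and> card P = 3) \<and>
            (\<exists>chi\<in>{-1<..<1}. \<exists>aleph\<in>{-1<..<1}.
               closed_Jordan_curve (C_tilde_plus z0 T chi \<union> C_tilde_minus z0 T chi) \<and>
               closed_Jordan_curve (C_hat_plus z0 T aleph \<union> C_hat_minus z0 T aleph) \<and>
               value_range T (complex_of_real z0) =
                 Jordan_ring (C_tilde_plus z0 T chi \<union> C_tilde_minus z0 T chi) (C_hat_plus z0 T aleph \<union> C_hat_minus z0 T aleph) \<and>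
               frontier (value_range T (complex_of_real z0)) =
                 C_tilde_plus z0 T chi \<union> C_tilde_minus z0 T chi \<union> C_hat_plus z0 T aleph \<union> C_hat_minus z0 T aleph)"
proof -
  define M where "M = {r \<in> {ra..rb}. pi \<le> S r}"
  have x0': "rad x0 \<in> {ra..rb}" "S (rad x0) = pi"
    using x0 rad_le_iff[of "-1" x0] rad_le_iff[of x0 1] angle_eq[of x0] by auto
  then have ne: "M \<noteq> {}" by (auto simp: M_def)
  have "closed M"
    unfolding M_def by (intro continuous_on_closed_Collect_le S_cont continuous_on_const) auto
  moreover have "bounded M" by (rule bounded_subset[of "{ra..rb}"]) (auto simp: M_def)
  ultimately have cM: "compact M" by (simp add: compact_eq_bounded_closed)
  obtain p where p: "p \<in> M" "\<And>r. r \<in> M \<Longrightarrow> p \<le> r" using compact_attains_inf[OF cM ne] by blast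
  obtain q where q: "q \<in> M" "\<And>r. r \<in> M \<Longrightarrow> r \<le> q" using compact_attains_sup[OF cM ne] by blast
  have pr: "ra \<le> p" "p \<le> rb" "pi \<le> S p" and qr: "ra \<le> q" "q \<le> rb" "pi \<le> S q"
    using p(1) q(1) by (auto simp: M_def)
  have Sp: "S p = pi"
  proof -
    obtain s where s: "ra \<le> s" "s \<le> p" "S s = pi"
      using IVT'[of S ra pi p] S_ends pr continuous_on_subset[OF S_cont, of "{ra..p}"] by auto
    then have "p \<le> s" using p(2)[of s] pr by (auto simp: M_def)
    then show ?thesis using s by simp
  qed
  have Sq: "S q = pi"
  proof -
    obtain s where s: "q \<le> s" "s \<le> rb" "S s = pi"
      using IVT2'[of S rb pi q] S_ends qr continuous_on_subset[OF S_cont, of "{q..rb}"] by auto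
    then have "s \<le> q" using q(2)[of s] qr by (auto simp: M_def)
    then show ?thesis using s by simp
  qed
  have strict: "ra < p" "q < rb" "p \<le> q"
    using Sp Sq S_ends pr qr p q by (auto simp: less_le)
  have low: "S r < pi" if "ra \<le> r" "r < p" for r
    using p(2)[of r] that pr by (force simp: M_def)
  have high: "S r < pi" if "q < r" "r \<le> rb" for r
    using q(2)[of r] that qr by (force simp: M_def)
  have middle: "pi \<le> S r" if "p \<le> r" "r \<le> q" for r
    using S_quasiconcave[of p r q] that pr qr by simp
  interpret O: fan_curve S q rb
  proof
    show "continuous_on {q..rb} S" using continuous_on_subset[OF S_cont] qr by auto
  qed (use rad_ends qr strict S_pos high Sq S_ends in auto)
  interpret I: fan_curve S ra p
  proof
    show "continuous_on {ra..p} S" using continuous_on_subset[OF S_cont] pr by auto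
  qed (use rad_ends pr strict S_pos low Sp S_ends in auto)
  obtain chi where chi: "-1 \<le> chi" "chi \<le> 1" "rad chi = q" using rad_surj[of q] qr by auto
  obtain aleph where aleph: "-1 \<le> aleph" "aleph \<le> 1" "rad aleph = p" using rad_surj[of p] pr by auto
  have chi1: "chi \<in> {-1<..<1}" and aleph1: "aleph \<in> {-1<..<1}"
    using chi aleph strict by (auto simp: less_le)
  have Ct: "C_tilde_plus z0 T chi \<union> C_tilde_minus z0 T chi = fan S q rb"
    unfolding C_tilde_plus_def C_tilde_minus_def using w_fan[of chi 1] chi by simp
  have Ch: "C_hat_plus z0 T aleph \<union> C_hat_minus z0 T aleph = fan S ra p"
    unfolding C_hat_plus_def C_hat_minus_def using w_fan[of "-1" aleph] aleph by simp
  note fo = O.fan_outer[OF Sq S_ends(2)] and fi = I.fan_inner[OF S_ends(1) Sp]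
  have V: "value_range T (of_real z0) = Jordan_ring (fan S q rb) (fan S ra p)"
  proof -
    have "z \<in> value_range T (of_real z0) \<longleftrightarrow> z \<in> Jordan_ring (fan S q rb) (fan S ra p)" for z
    proof -
      have reg: "Jordan_region (fan S q rb) = {z. norm z < q \<or> q \<le> norm z \<and> norm z \<le> rb \<and> aarg z \<le> S (norm z)}"
        unfolding Jordan_region_def fo(1) using fo(2) by blast
      have ins: "inside (fan S ra p) = {z. norm z < ra \<or> ra \<le> norm z \<and> norm z \<le> p \<and> S (norm z) < aarg z}"
        unfolding fi(1) by (auto simp: I.fan_eq')
      consider "norm z < ra" | "ra \<le> norm z" "norm z < p" | "p \<le> norm z" "norm z \<le> q" | "q < norm z"
        by linarith
      then show ?thesis
      proof cases
        case 3
        then have "z \<noteq> 0" using strict rad_ends by auto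
        then have "aarg z \<le> S (norm z)" using aarg_bounds(2)[of z] middle 3 by fastforce
        then show ?thesis using 3 strict unfolding Jordan_ring_def reg ins value_range_eq by auto
      qed (use strict in \<open>auto simp: Jordan_ring_def reg ins value_range_eq\<close>)
    qed
    then show ?thesis by blast
  qed
  have "fan S q rb \<union> fan S ra p \<subseteq> value_range T (of_real z0)"
    unfolding value_range_eq O.fan_eq' I.fan_eq' using strict by auto
  then have fr: "frontier (value_range T (of_real z0)) = fan S q rb \<union> fan S ra p"
    unfolding V using frontier_Jordan_ring[OF O.Jordan I.Jordan] by simp
  \<comment> \<open>The additional common point \<open>w_plus z0 T chi\<close> is \<open>- q\<close>
    on the negative real axis; the moduli \<open>ra < q < rb\<close> tell the three points
    apart.\<close>
  let ?P = "{w_plus z0 T (-1), w_plus z0 T chi, w_plus z0 T 1}"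
  have nw: "norm (w_plus z0 T x) = rad x" if "-1 \<le> x" "x \<le> 1" for x
    using rad[OF that] by (simp add: w_plus_def norm_mult)
  have "card ?P = 3"
  proof -
    have "norm (w_plus z0 T (-1)) < norm (w_plus z0 T chi)" "norm (w_plus z0 T chi) < norm (w_plus z0 T 1)"
      using nw[of "-1"] nw[of chi] nw[of 1] chi strict by auto
    then have "w_plus z0 T (-1) \<noteq> w_plus z0 T chi" "w_plus z0 T chi \<noteq> w_plus z0 T 1"
      "w_plus z0 T (-1) \<noteq> w_plus z0 T 1" by auto
    then show ?thesis by simp
  qed
  moreover have "?P \<subseteq> C_plus z0 T \<inter> C_minus z0 T"
  proof -
    have "w_plus z0 T x = w_minus z0 T x" if "x \<in> {-1, chi, 1}" for x
    proof -
      have "S (rad x) \<in> {0, pi}" using that Sq S_ends chi by auto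
      moreover have "angle z0 T x = S (rad x)" using that chi by (auto intro: angle_eq)
      ultimately show ?thesis by (auto simp: w_plus_def w_minus_def exp_minus)
    qed
    then have "w_plus z0 T x \<in> C_plus z0 T \<inter> C_minus z0 T" if "x \<in> {-1, chi, 1}" for x
      using that chi unfolding C_plus_def C_minus_def by (auto intro!: image_eqI[of _ _ x])
    then show ?thesis by blast
  qed
  ultimately have P: "\<exists>P. P \<subseteq> C_plus z0 T \<inter> C_minus z0 T \<and> card P = 3" by blast
  have fr': "frontier (value_range T (of_real z0)) = fan S q rb \<union> C_hat_plus z0 T aleph \<union> C_hat_minus z0 T aleph"
    unfolding fr Ch[symmetric] by (rule Un_assoc[symmetric])
  show ?thesis
    by (rule conjI[OF P], rule bexI[OF _ chi1], rule bexI[OF _ aleph1], unfold Ct Ch)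
      (intro conjI O.Jordan I.Jordan V fr')
qed

end

theorem theorem1p1:
  fixes z0 T :: real
  assumes "z0 \<in> {0<..<1}" and "T > 0"
  shows "(\<forall>x\<in>{-1..1}. \<exists>!r. r \<in> {0<..<1} \<and> radius_equation z0 T x r) \<and>
         (artanh z0 < pi / 2 \<longrightarrow>
            closed_Jordan_curve (C_plus z0 T \<union> C_minus z0 T) \<and>
            value_range T (complex_of_real z0) = Jordan_region (C_plus z0 T \<union> C_minus z0 T) \<and>
            frontier (value_range T (complex_of_real z0)) = C_plus z0 T \<union> C_minus z0 T \<and>
            C_plus z0 T \<inter> C_minus z0 T = {w_plus z0 T (-1), w_plus z0 T 1} \<and>
            w_plus z0 T (-1) = w_minus z0 T (-1) \<and> w_plus z0 T 1 = w_minus z0 T 1) \<and>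
         (artanh z0 \<ge> pi / 2 \<and> (\<exists>x\<in>{-1..1}. angle z0 T x = pi) \<longrightarrow>
            (\<exists>P. P \<subseteq> C_plus z0 T \<inter> C_minus z0 T \<and> card P = 3) \<and>
            (\<exists>chi\<in>{-1<..<1}. \<exists>aleph\<in>{-1<..<1}.
               closed_Jordan_curve (C_tilde_plus z0 T chi \<union> C_tilde_minus z0 T chi) \<and>
               closed_Jordan_curve (C_hat_plus z0 T aleph \<union> C_hat_minus z0 T aleph) \<and>
               value_range T (complex_of_real z0) =
                 Jordan_ring (C_tilde_plus z0 T chi \<union> C_tilde_minus z0 T chi) (C_hat_plus z0 T aleph \<union> C_hat_minus z0 T aleph) \<and>
               frontier (value_range T (complex_of_real z0)) =
                 C_tilde_plus z0 T chi \<union> C_tilde_minus z0 T chi \<union> C_hat_plus z0 T aleph \<union> C_hat_minus z0 T aleph)) \<and>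
         (artanh z0 \<ge> pi / 2 \<and> \<not> (\<exists>x\<in>{-1..1}. angle z0 T x = pi) \<longrightarrow>
            closed_Jordan_curve (C_plus z0 T \<union> C_minus z0 T) \<and>
            value_range T (complex_of_real z0) = Jordan_region (C_plus z0 T \<union> C_minus z0 T) \<and>
            frontier (value_range T (complex_of_real z0)) = C_plus z0 T \<union> C_minus z0 T \<and>
            C_plus z0 T \<inter> C_minus z0 T = {w_plus z0 T (-1), w_plus z0 T 1} \<and>
            w_plus z0 T (-1) = w_minus z0 T (-1) \<and> w_plus z0 T 1 = w_minus z0 T 1)"
proof -
  interpret value_region z0 T using assms by unfold_locales auto
  have small: "S r \<noteq> pi" if "artanh z0 < pi / 2" "ra \<le> r" "r \<le> rb" for r
    using S_less_artanh[OF that(2,3)] that(1) by auto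
  have no_sol: "S r \<noteq> pi" if no: "\<not> (\<exists>x\<in>{-1..1}. angle z0 T x = pi)" and r: "ra \<le> r" "r \<le> rb" for r
  proof
    assume "S r = pi"
    obtain x where "-1 \<le> x" "x \<le> 1" "rad x = r" using rad_surj[OF r] .
    then show False using no angle_eq \<open>S r = pi\<close> by auto
  qed
  have ex: "\<forall>x\<in>{-1..1}. \<exists>!r. r \<in> {0<..<1} \<and> radius_equation z0 T x r"
    using radius_ex1 by simp
  show ?thesis
    by (rule conjI[OF ex], rule conjI[OF impI conjI[OF impI impI]],
        rule simple_case, rule small, assumption+,
        elim conjE bexE, rule ring_case, assumption+,
        rule simple_case, rule no_sol, erule conjunct2, assumption+)
qed

end
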